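(* Let $\varphi_j:\mathbb{R}^n\to[0,1]$, $j\ge1$, be a sequence of Borel-measurable functions such that each $\varphi_j$ is almost invariant under $G(\mathfrak{M}_0)$, is neither $\lambda_{\mathbb{R}^n}$-almost everywhere equal to $1$ nor $\lambda_{\mathbb{R}^n}$-almost everywhere equal to $0$, and satisfies $\varphi_j(x+z)=\varphi_j(x)$ for every $x\in\mathbb{R}^n$ and every $z\in J(\mathfrak{C})$. Assume that $\mathfrak{C}$ is bounded (as a subset of $\mathbb{R}^{n\times n}$) and that for every sequence $\Sigma_m\in\mathfrak{C}$ converging to a singular $\bar\Sigma$ there exist a subsequence $(m_i)_{i\in\mathbb{N}}$ and positive reals $s_{m_i}$ such that $D_{m_i}=\Pi_{\operatorname{span}(\bar\Sigma)^\perp}\Sigma_{m_i}\Pi_{\operatorname{span}(\bar\Sigma)^\perp}/s_{m_i}$ converges to a matrix $D$ whose associated linear map is injective when restricted to $\operatorname{span}(\bar\Sigma)^\perp$. Furthermore assume that $E_{\mu_0^*,\Phi}(\varphi_j)\downarrow0$ (monotonically) as $j\uparrow\infty$ for some $\mu_0^*\in\mathfrak{M}_0$ and all positive definite symmetric $n\times n$ matrices $\Phi$. Then for every $\delta$, $0<\delta<1$, there exists $j_0=j_0(\delta)$ such that $$\sup_{\mu_0\in\mathfrak{M}_0}\sup_{0<\sigma^2<\infty}\sup_{\Sigma\in\mathfrak{C}}E_{\mu_0,\sigma^2\Sigma}(\varphi_{j_0})\le\delta.$$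
   Context: Framework: $n,k,q$ are integers with $1\le k<n$, $q\ge1$; $X$ is a fixed real $n\times k$ matrix of rank $k$; $R$ is a fixed real $q\times k$ matrix of rank $q$; $r\in\mathbb{R}^q$. $\mathfrak{C}$ (covariance model) is a nonempty set of symmetric positive definite $n\times n$ matrices such that $\sigma^2\in(0,\infty)$ and $\Sigma\in\mathfrak{C}$ are uniquely determined by $\sigma^2\Sigma$. $\mathfrak{M}_0=\{X\beta:\beta\in\mathbb{R}^k,\ R\beta=r\}$. $E_{\mu,\Phi}$ is expectation under the Gaussian measure on $\mathbb{R}^n$ with mean $\mu$ and covariance matrix $\Phi$. $\Pi_{\mathcal{L}}$ is the orthogonal projection onto the linear subspace $\mathcal{L}$; $\operatorname{span}$ of a matrix is its column space; $\lambda_{\mathbb{R}^n}$ is Lebesgue measure. $J(\mathfrak{C})=\bigcup\{\operatorname{span}(\bar\Sigma):\det\bar\Sigma=0,\ \bar\Sigma=\lim_{m\to\infty}\Sigma_m\text{ for a sequence }\Sigma_m\in\mathfrak{C}\}$ (possibly empty). $G(\mathfrak{M}_0)$ is the group of maps $y\mapsto\alpha(y-\mu_0)+\mu_0'$ with $\alpha\ne0$ real and $\mu_0,\mu_0'\in\mathfrak{M}_0$. A function $S$ on $\mathbb{R}^n$ is almost invariant under $G$ if for each $g\in G$ there is a Borel set $N(g)$ with $\lambda_{\mathbb{R}^n}(N(g))=0$ and $\lambda_{\mathbb{R}^n}(g'^{-1}(N(g)))=0$ for all $g'\in G$ such that $S(g(y))=S(y)$ for all $y\in\mathbb{R}^n\setminus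 N(g)$. *)

theory Defs
  imports "HOL-Analysis.Analysis"
begin

definition pos_def_matrix :: "real^'n^'n \<Rightarrow> bool" where
  "pos_def_matrix A \<longleftrightarrow> transpose A = A \<and> (\<forall>x. x \<noteq> 0 \<longrightarrow> x \<bullet> (A *v x) > 0)"

text \<open>The second conjunct says that the real number \<open>s > 0\<close> (the variance \<open>\<sigma>\<^sup>2\<close>) and \<open>A \<in> C\<close>
  are uniquely determined by the product \<open>s A\<close>.\<close>

definition covariance_model :: "(real^'n^'n) set \<Rightarrow> bool" where
  "covariance_model C \<longleftrightarrow>
     C \<noteq> {} \<and> (\<forall>A\<in>C. pos_def_matrix A) \<and>
     (\<forall>A\<in>C. \<forall>B\<in>C. \<forall>s>0. \<forall>t>0. s *\<^sub>R A = t *\<^sub>R B \<longrightarrow> s = t \<and> A = B)"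

definition null_hypothesis :: "real^'k^'n \<Rightarrow> real^'k^'q \<Rightarrow> real^'q \<Rightarrow> (real^'n) set" where
  "null_hypothesis X R r = {X *v \<beta> | \<beta>. R *v \<beta> = r}"

text \<open>Gaussian measure with mean \<open>\<mu>\<close> and covariance matrix \<open>\<Phi>\<close>, given by its Lebesgue density.
  The definition is meaningful only for positive definite \<open>\<Phi>\<close>, the only case in which it is used.\<close>

definition gaussian_measure :: "real^'n \<Rightarrow> real^'n^'n \<Rightarrow> (real^'n) measure" where
  "gaussian_measure \<mu> \<Phi> = density lborel
     (\<lambda>y. ennreal (exp (- ((y - \<mu>) \<bullet> (matrix_inv \<Phi> *v (y - \<mu>))) / 2) /
                   sqrt ((2 * pi) ^ CARD('n) * det \<Phi>)))"

definition column_space :: "real^'k^'n \<Rightarrow> (real^'n) set" where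
  "column_space A = span (columns A)"

definition orth_proj :: "(real^'n) set \<Rightarrow> real^'n \<Rightarrow> real^'n" where
  "orth_proj L x = (THE y. y \<in> L \<and> x - y \<in> L\<^sup>\<bottom>)"

definition proj_matrix :: "(real^'n) set \<Rightarrow> real^'n^'n" where
  "proj_matrix L = matrix (orth_proj L)"

lemma orth_proj_eqI:
  fixes L :: "(real^'n) set"
  assumes "subspace L" "y \<in> L" "x - y \<in> L\<^sup>\<bottom>"
  shows "orth_proj L x = y"
  unfolding orth_proj_def
proof (rule the_equality)
  fix z assume z: "z \<in> L \<and> x - z \<in> L\<^sup>\<bottom>"
  have "(x - y) - (x - z) \<in> L\<^sup>\<bottom>"
    using z assms(3) subspace_diff[OF subspace_orthogonal_comp] by blast
  moreover have "z - y \<in> L"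
    using z assms subspace_diff by blast
  ultimately have "orthogonal (z - y) (z - y)"
    by (auto simp: orthogonal_comp_def)
  then show "z = y"
    by (simp add: orthogonal_self)
qed (use assms in auto)

lemma orth_proj:
  fixes L :: "(real^'n) set"
  assumes "subspace L"
  shows "orth_proj L x \<in> L" and "x - orth_proj L x \<in> L\<^sup>\<bottom>"
proof -
  obtain y z where yz: "y \<in> span L" "\<And>w. w \<in> span L \<Longrightarrow> orthogonal z w" "x = y + z"
    using orthogonal_subspace_decomp_exists[of L x] by blast
  have L: "span L = L"
    using assms by (simp add: span_eq_iff)
  have y: "y \<in> L" "x - y \<in> L\<^sup>\<bottom>"
    using yz unfolding L by (auto simp: orthogonal_comp_def orthogonal_commute)
  then have "orth_proj L x = y"
    by (rule orth_proj_eqI[OF assms])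
  then show "orth_proj L x \<in> L" "x - orth_proj L x \<in> L\<^sup>\<bottom>"
    using y by auto
qed

lemma linear_orth_proj:
  fixes L :: "(real^'n) set"
  assumes "subspace L"
  shows "linear (orth_proj L)"
proof (rule linearI)
  fix x y :: "real^'n" and c :: real
  show "orth_proj L (x + y) = orth_proj L x + orth_proj L y"
  proof (rule orth_proj_eqI[OF assms])
    show "orth_proj L x + orth_proj L y \<in> L"
      using orth_proj(1)[OF assms] assms by (simp add: subspace_add)
    have "(x - orth_proj L x) + (y - orth_proj L y) \<in> L\<^sup>\<bottom>"
      using orth_proj(2)[OF assms] by (intro subspace_add subspace_orthogonal_comp)
    then show "x + y - (orth_proj L x + orth_proj L y) \<in> L\<^sup>\<bottom>"
      by (simp add: algebra_simps)
  qed
  show "orth_proj L (c *\<^sub>R x) = c *\<^sub>R orth_proj L x"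
  proof (rule orth_proj_eqI[OF assms])
    show "c *\<^sub>R orth_proj L x \<in> L"
      using orth_proj(1)[OF assms] assms by (simp add: subspace_scale)
    have "c *\<^sub>R (x - orth_proj L x) \<in> L\<^sup>\<bottom>"
      using orth_proj(2)[OF assms] by (intro subspace_scale subspace_orthogonal_comp)
    then show "c *\<^sub>R x - c *\<^sub>R orth_proj L x \<in> L\<^sup>\<bottom>"
      by (simp add: algebra_simps)
  qed
qed

lemma proj_matrix_mult:
  fixes L :: "(real^'n) set"
  assumes "subspace L"
  shows "proj_matrix L *v x = orth_proj L x"
  using linear_orth_proj[OF assms] by (simp add: proj_matrix_def matrix_works)

definition concentration_set :: "(real^'n^'n) set \<Rightarrow> (real^'n) set" where
  "concentration_set C =
     \<Union> {column_space A | A. det A = 0 \<and> (\<exists>S. (\<forall>m. S m \<in> C) \<and> S \<longlonglongrightarrow> A)}"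

definition invariance_group :: "(real^'n) set \<Rightarrow> (real^'n \<Rightarrow> real^'n) set" where
  "invariance_group M =
     {\<lambda>y. \<alpha> *\<^sub>R (y - \<mu>) + \<mu>' | \<alpha> \<mu> \<mu>'. \<alpha> \<noteq> 0 \<and> \<mu> \<in> M \<and> \<mu>' \<in> M}"

definition almost_invariant ::
    "(real^'n \<Rightarrow> real^'n) set \<Rightarrow> (real^'n \<Rightarrow> 'b) \<Rightarrow> bool" where
  "almost_invariant G S \<longleftrightarrow>
     (\<forall>g\<in>G. \<exists>N. N \<in> null_sets lborel \<and> (\<forall>g'\<in>G. g' -` N \<in> null_sets lborel) \<and>
        (\<forall>y. y \<notin> N \<longrightarrow> S (g y) = S y))"

end

theory Submission
  imports Defs "HOL-Probability.Distributions"
begin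

text \<open>
  By invariance under the group, the expectation of \<open>\<phi>\<^sub>j\<close> under a Gaussian measure with mean in the null
  hypothesis and covariance \<open>\<sigma>\<^sup>2 \<Sigma>\<close> depends only on \<open>\<Sigma>\<close> (\<open>gaussian_integral_invariance_group\<close>). So
  the expectations \<open>E\<^sub>j(\<Sigma>)\<close> at the fixed mean \<open>\<mu>\<^sub>0\<close> have to become small uniformly over \<open>C\<close>. They
  decrease to \<open>0\<close> at each positive definite matrix and are continuous there, so Dini's argument would
  apply if \<open>C\<close> were compact within the positive definite matrices. It is only bounded, and the difficulty
  is a sequence in \<open>C\<close> that approaches a singular matrix, where the Gaussian measures degenerate to the
  column space \<open>L\<close> of the limit.

  The invariance of \<open>\<phi>\<^sub>j\<close> under translations by \<open>L\<close> removes this obstacle. Such a function depends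
  only on the component of its argument orthogonal to \<open>L\<close>, hence its expectation only on the compression of
  the covariance to \<open>L\<^sup>\<bottom>\<close>; the rest of the covariance can be replaced by the projection onto \<open>L\<close>
  (\<open>gaussian_integral_compression\<close>). By scale invariance the compression can be divided by the
  normalising constants, after which it converges to a matrix that is positive semidefinite and injective on
  \<open>L\<^sup>\<bottom>\<close>, therefore positive definite there (\<open>pos_def_limit_compression\<close>). So every sequence in \<open>C\<close>
  has a subsequence along which all \<open>E\<^sub>j\<close> converge to their values at one positive definite matrix
  (\<open>gaussian_expectation_subsequence\<close>), and this much compactness suffices for Dini's argument.

  Two tools make this precise. A linear change of variables turns a congruence
  \<open>T \<Phi> T\<^sup>T\<close> of covariances into a substitution in the integral (\<open>gaussian_integral_congruence\<close>); the
  replacement of the covariance then amounts to finding a suitable \<open>T\<close> by Gram--Schmidt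
  (\<open>whitening_matrix\<close>). Continuity in the covariance is dominated convergence
  (\<open>gaussian_integral_tendsto\<close>).
\<close>

section \<open>Linear change of variables for Lebesgue measure\<close>

lemma borel_measurable_matrix_vector_mult [measurable (raw)]:
  fixes A :: "real^'n^'m"
  assumes "f \<in> borel_measurable M"
  shows "(\<lambda>x. A *v f x) \<in> borel_measurable M"
  using measurable_comp[OF assms borel_measurable_continuous_onI[of "(*v) A"]]
  by (simp add: o_def linear_continuous_on linear_linear)

lemma prod_Basis_axis:
  "(\<Prod>b\<in>(Basis :: (real^'n) set). g b) = (\<Prod>i\<in>UNIV. g (axis i 1))"
proof -
  have "(Basis :: (real^'n) set) = range (\<lambda>i. axis i 1)"
    by (auto simp: Basis_vec_def)
  moreover have "inj (\<lambda>i::'n. axis i (1::real))"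
    by (simp add: inj_on_def axis_eq_axis)
  ultimately show ?thesis
    using prod.reindex[of "\<lambda>i::'n. axis i (1::real)" UNIV g] by (simp add: o_def)
qed

text \<open>The change of variables formula for an invertible matrix, as an equation of measures. The case
  of a singular matrix is made trivial so that the property can be proved by induction over
  elementary matrices, a factor of which may be singular.\<close>

definition scales_lborel :: "real^'n^'n \<Rightarrow> bool" where
  "scales_lborel A \<longleftrightarrow> (det A \<noteq> 0 \<longrightarrow>
     lborel = density (distr lborel borel ((*v) A)) (\<lambda>_. ennreal \<bar>det A\<bar>))"

lemma nn_integral_scales_lborel:
  fixes A :: "real^'n^'n"
  assumes "scales_lborel A" "det A \<noteq> 0" "f \<in> borel_measurable borel"
  shows "(\<integral>\<^sup>+x. f x \<partial>lborel) = ennreal \<bar>det A\<bar> * (\<integral>\<^sup>+x. f (A *v x) \<partial>lborel)"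
proof -
  have [measurable]: "f \<in> borel_measurable borel"
    using assms by simp
  have "(\<integral>\<^sup>+x. f x \<partial>lborel) = (\<integral>\<^sup>+x. f x \<partial>density (distr lborel borel ((*v) A)) (\<lambda>_. ennreal \<bar>det A\<bar>))"
    using assms unfolding scales_lborel_def by metis
  also have "\<dots> = (\<integral>\<^sup>+x. ennreal \<bar>det A\<bar> * f (A *v x) \<partial>lborel)"
    by (subst nn_integral_density) (auto simp: nn_integral_distr)
  finally show ?thesis
    by (simp add: nn_integral_cmult)
qed

lemma scales_lborelI:
  fixes A :: "real^'n^'n"
  assumes "\<And>f. det A \<noteq> 0 \<Longrightarrow> f \<in> borel_measurable borel \<Longrightarrow>
    (\<integral>\<^sup>+x. f x \<partial>lborel) = ennreal \<bar>det A\<bar> * (\<integral>\<^sup>+x. f (A *v x) \<partial>lborel)"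
  shows "scales_lborel A"
  unfolding scales_lborel_def
proof (intro impI measure_eqI)
  fix S :: "(real^'n) set"
  assume d: "det A \<noteq> 0" and "S \<in> sets lborel"
  then have S [measurable]: "S \<in> sets borel"
    by simp
  have "emeasure lborel S = ennreal \<bar>det A\<bar> * (\<integral>\<^sup>+x. indicator S (A *v x) \<partial>lborel)"
    using assms[OF d, of "indicator S"] by simp
  also have "(\<integral>\<^sup>+x. indicator S (A *v x) \<partial>lborel) = emeasure (distr lborel borel ((*v) A)) S"
    using nn_integral_distr[of "(*v) A" lborel borel "indicator S"] by simp
  also have "ennreal \<bar>det A\<bar> * \<dots> = emeasure (density (distr lborel borel ((*v) A)) (\<lambda>_. ennreal \<bar>det A\<bar>)) S"
    by (simp add: emeasure_density nn_integral_cmult_indicator)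
  finally show "emeasure lborel S = \<dots>" .
qed simp

lemma scales_lborel_diagonal:
  fixes A :: "real^'n^'n"
  assumes "\<And>i j. i \<noteq> j \<Longrightarrow> A $ i $ j = 0"
  shows "scales_lborel A"
  unfolding scales_lborel_def
proof
  assume "det A \<noteq> 0"
  then have nz: "A $ i $ i \<noteq> 0" for i
    by (auto simp: det_diagonal[OF assms])
  define c :: "real^'n \<Rightarrow> real" where "c b = b \<bullet> (A *v b)" for b
  have mul: "A *v x = (\<chi> i. A $ i $ i * x $ i)" for x
  proof -
    have "(\<Sum>j\<in>UNIV. A $ i $ j * x $ j) = (\<Sum>j\<in>UNIV. if j = i then A $ i $ i * x $ i else 0)" for i
      using assms by (intro sum.cong) auto
    then show ?thesis
      by (simp add: matrix_vector_mult_def vec_eq_iff)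
  qed
  have c_axis: "c (axis i 1) = A $ i $ i" for i
    by (simp add: c_def mul inner_axis')
  have "A *v x = 0 + (\<Sum>b\<in>Basis. (c b * (x \<bullet> b)) *\<^sub>R b)" for x
  proof -
    have "(A *v x) \<bullet> b = c b * (x \<bullet> b)" if "b \<in> Basis" for b
      using that by (auto simp: Basis_vec_def c_axis inner_axis mul)
    then have "A *v x = (\<Sum>b\<in>Basis. (c b * (x \<bullet> b)) *\<^sub>R b)"
      by (metis (no_types, lifting) euclidean_representation sum.cong)
    then show ?thesis
      by simp
  qed
  moreover have "c b \<noteq> 0" if "b \<in> Basis" for b
    using that nz by (auto simp: Basis_vec_def c_axis)
  moreover have "(\<Prod>b\<in>Basis. \<bar>c b\<bar>) = \<bar>det A\<bar>"
    by (simp add: prod_Basis_axis c_axis det_diagonal[OF assms] abs_prod)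
  ultimately show "lborel = density (distr lborel borel ((*v) A)) (\<lambda>_. ennreal \<bar>det A\<bar>)"
    using lborel_affine_euclidean[of c 0] by presburger
qed

text \<open>A coordinate swap maps boxes to boxes and permutes their side lengths.\<close>

lemma scales_lborel_transpose:
  fixes m n :: "'n::finite"
  shows "scales_lborel (\<chi> i j. mat 1 $ i $ Transposition.transpose m n j :: real^'n^'n)" (is "scales_lborel ?A")
proof -
  let ?p = "Transposition.transpose m n"
  have mul: "?A *v x = (\<chi> i. x $ ?p i)" for x
  proof -
    have "(\<Sum>j\<in>UNIV. mat 1 $ i $ ?p j * x $ j) = (\<Sum>j\<in>UNIV. if j = ?p i then x $ j else 0)" for i
      by (intro sum.cong refl) (auto simp: mat_def)
    then show ?thesis
      by (simp add: vec_eq_iff matrix_vector_mult_def)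
  qed
  have p: "?p permutes UNIV"
    by (simp add: permutes_swap_id)
  have det: "\<bar>det ?A\<bar> = 1"
    by (simp add: det_permute_columns[OF p] sign_def)
  have "lborel = distr lborel borel ((*v) ?A)"
  proof (rule lborel_eqI)
    fix l u :: "real^'n"
    assume le: "\<And>b. b \<in> Basis \<Longrightarrow> l \<bullet> b \<le> u \<bullet> b"
    have le': "l $ i \<le> u $ i" for i
      using le[of "axis i 1"] by (simp add: axis_in_Basis_iff inner_axis)
    have "(*v) ?A -` box l u = box (?A *v l) (?A *v u)"
      by (auto simp: mul mem_box_cart) (metis transpose_involutory)+
    then have "emeasure (distr lborel borel ((*v) ?A)) (box l u) = emeasure lborel (box (?A *v l) (?A *v u))"
      by (simp add: emeasure_distr)
    also have "\<dots> = (\<Prod>i\<in>UNIV. (u - l) $ ?p i)"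
    proof (subst emeasure_lborel_box)
      show "(?A *v l) \<bullet> b \<le> (?A *v u) \<bullet> b" if "b \<in> Basis" for b
        using that by (auto simp: Basis_vec_def inner_axis mul le')
    qed (simp add: prod_Basis_axis inner_axis mul)
    also have "(\<Prod>i\<in>UNIV. (u - l) $ ?p i) = (\<Prod>i\<in>UNIV. (u - l) $ i)"
      using prod.permute[OF p, of "\<lambda>i. (u - l) $ i"] by (simp add: o_def)
    finally show "emeasure (distr lborel borel ((*v) ?A)) (box l u) = (\<Prod>b\<in>Basis. (u - l) \<bullet> b)"
      by (simp add: prod_Basis_axis inner_axis)
  qed simp
  then show ?thesis
    unfolding scales_lborel_def det by (metis density_1 ennreal_1)
qed

text \<open>Fubini: once the coordinates other than the \<open>m\<close>-th are fixed, the shear translates the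
  \<open>m\<close>-th coordinate by a constant, which Lebesgue measure on the line does not notice.\<close>

lemma scales_lborel_shear:
  fixes m n :: "'n::finite"
  assumes "m \<noteq> n"
  shows "scales_lborel (\<chi> i j. of_bool (i = m \<and> j = n \<or> i = j) :: real^'n^'n)" (is "scales_lborel ?A")
proof (rule scales_lborelI)
  have "?A = (\<chi> k. if k = m then row m (mat 1) + 1 *s row n (mat 1) else row k (mat 1))"
    using assms by (auto simp: vec_eq_iff row_def mat_def)
  then have det: "det ?A = 1"
    by (simp only: det_row_operation[OF assms] det_I)
  have mul: "?A *v x = x + (x $ n) *\<^sub>R axis m 1" for x
  proof -
    have "(\<Sum>j\<in>UNIV. of_bool (i = m \<and> j = n \<or> i = j) * x $ j) = x $ i + x $ n * of_bool (i = m)" for i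
    proof -
      have "(\<Sum>j\<in>UNIV. of_bool (i = m \<and> j = n \<or> i = j) * x $ j)
          = (\<Sum>j\<in>UNIV. (if j = i then x $ j else 0) + (if j = n then of_bool (i = m) * x $ j else 0))"
        using assms by (intro sum.cong) auto
      then show ?thesis
        by (simp add: sum.distrib)
    qed
    then show ?thesis
      by (simp add: vec_eq_iff matrix_vector_mult_def axis_def)
  qed
  fix f :: "real^'n \<Rightarrow> ennreal"
  assume [measurable]: "f \<in> borel_measurable borel"
  interpret product_sigma_finite "\<lambda>_ :: real^'n. lborel :: real measure" ..
  let ?e = "axis m 1 :: real^'n" and ?d = "axis n 1 :: real^'n"
  let ?B = "Basis - {?e}"
  \<comment> \<open>a point of the product space over the basis, read as a vector\<close>
  let ?v = "\<lambda>y. \<Sum>b\<in>Basis. y b *\<^sub>R b :: real^'n"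
  have e: "?e \<in> Basis" and d: "?d \<in> ?B"
    using assms by (auto simp: axis_in_Basis_iff axis_eq_axis)
  have split: "(\<integral>\<^sup>+x. g x \<partial>lborel) =
      (\<integral>\<^sup>+y. \<integral>\<^sup>+t. g (t *\<^sub>R ?e + (\<Sum>b\<in>?B. y b *\<^sub>R b)) \<partial>lborel \<partial>Pi\<^sub>M ?B (\<lambda>_. lborel))"
    if [measurable]: "g \<in> borel_measurable borel" for g :: "real^'n \<Rightarrow> ennreal"
  proof -
    have ins: "insert ?e ?B = Basis"
      using e by auto
    have v: "?v (y(?e := t)) = t *\<^sub>R ?e + (\<Sum>b\<in>?B. y b *\<^sub>R b)" for y t
      using e by (subst sum.remove[where x = ?e]) (auto intro!: sum.cong)
    have "(\<integral>\<^sup>+x. g x \<partial>lborel) = (\<integral>\<^sup>+y. g (?v y) \<partial>Pi\<^sub>M (insert ?e ?B) (\<lambda>_. lborel))"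
      unfolding ins by (subst lborel_eq) (simp add: nn_integral_distr)
    also have "\<dots> = (\<integral>\<^sup>+y. \<integral>\<^sup>+t. g (?v (y(?e := t))) \<partial>lborel \<partial>Pi\<^sub>M ?B (\<lambda>_. lborel))"
      by (rule product_nn_integral_insert) (auto simp: ins)
    finally show ?thesis
      unfolding v .
  qed
  have mul_split: "?A *v (t *\<^sub>R ?e + (\<Sum>b\<in>?B. y b *\<^sub>R b)) = (y ?d + 1 * t) *\<^sub>R ?e + (\<Sum>b\<in>?B. y b *\<^sub>R b)" for y t
  proof -
    define z where "z = (\<Sum>b\<in>?B. y b *\<^sub>R b)"
    have "z \<bullet> ?d = y ?d"
      unfolding z_def
      using d by (simp add: inner_sum_left inner_Basis if_distrib[of "\<lambda>x. _ * x"] cong: if_cong)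
    then have "z $ n = y ?d"
      by (simp add: inner_axis)
    moreover have "?e $ n = 0"
      using assms by (simp add: axis_def)
    ultimately have "(t *\<^sub>R ?e + z) $ n = y ?d"
      by simp
    then show ?thesis
      unfolding mul z_def[symmetric] by (simp add: algebra_simps)
  qed
  have shift: "(\<integral>\<^sup>+t. f (?A *v (t *\<^sub>R ?e + (\<Sum>b\<in>?B. y b *\<^sub>R b))) \<partial>lborel)
      = (\<integral>\<^sup>+t. f (t *\<^sub>R ?e + (\<Sum>b\<in>?B. y b *\<^sub>R b)) \<partial>lborel)" for y
    unfolding mul_split
    using nn_integral_real_affine[of "\<lambda>t. f (t *\<^sub>R ?e + (\<Sum>b\<in>?B. y b *\<^sub>R b))" 1 "y ?d"]
    by simp
  have "(\<integral>\<^sup>+x. f (?A *v x) \<partial>lborel) = (\<integral>\<^sup>+x. f x \<partial>lborel)"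
    by (subst (1 2) split) (simp_all only: shift, simp_all)
  then show "(\<integral>\<^sup>+x. f x \<partial>lborel) = ennreal \<bar>det ?A\<bar> * (\<integral>\<^sup>+x. f (?A *v x) \<partial>lborel)"
    unfolding det by simp
qed

text \<open>Every square matrix is a product of elementary matrices and matrices with a zero row, and the
  formula is inherited by products because the determinant is multiplicative.\<close>

lemma scales_lborel: "scales_lborel A"
proof (rule induct_matrix_elementary_alt)
  fix A B :: "real^'n^'n"
  assume A: "scales_lborel A" and B: "scales_lborel B"
  show "scales_lborel (A ** B)"
  proof (rule scales_lborelI)
    fix f :: "real^'n \<Rightarrow> ennreal"
    assume d: "det (A ** B) \<noteq> 0" and f [measurable]: "f \<in> borel_measurable borel"
    have "(\<integral>\<^sup>+x. f x \<partial>lborel) = ennreal \<bar>det A\<bar> * (\<integral>\<^sup>+x. f (A *v x) \<partial>lborel)"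
      using A d by (intro nn_integral_scales_lborel) (auto simp: det_mul)
    also have "(\<integral>\<^sup>+x. f (A *v x) \<partial>lborel) = ennreal \<bar>det B\<bar> * (\<integral>\<^sup>+x. f (A *v (B *v x)) \<partial>lborel)"
      using B d by (intro nn_integral_scales_lborel) (auto simp: det_mul)
    finally show "(\<integral>\<^sup>+x. f x \<partial>lborel) = ennreal \<bar>det (A ** B)\<bar> * (\<integral>\<^sup>+x. f (A ** B *v x) \<partial>lborel)"
      by (simp add: det_mul abs_mult ennreal_mult mult.assoc matrix_vector_mul_assoc)
  qed
next
  show "scales_lborel A" if "row i A = 0" for A :: "real^'n^'n" and i
    using that by (simp add: scales_lborel_def det_zero_row)
qed (blast intro: scales_lborel_diagonal scales_lborel_transpose scales_lborel_shear)+

lemma integral_linear_change_of_variables: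
  fixes T :: "real^'n^'n" and f :: "real^'n \<Rightarrow> real"
  assumes "det T \<noteq> 0" and [measurable]: "f \<in> borel_measurable borel"
  shows "(\<integral>x. f x \<partial>lborel) = (\<integral>x. \<bar>det T\<bar> * f (T *v x) \<partial>lborel)"
proof -
  have "(\<integral>x. f x \<partial>lborel) = (\<integral>x. f x \<partial>density (distr lborel borel ((*v) T)) (\<lambda>_. ennreal \<bar>det T\<bar>))"
    using scales_lborel[of T] assms(1) unfolding scales_lborel_def by metis
  also have "\<dots> = (\<integral>x. \<bar>det T\<bar> * f (T *v x) \<partial>lborel)"
    by (simp add: integral_density integral_distr)
  finally show ?thesis .
qed

section \<open>Positive definite matrices and whitening\<close>

lemma inner_transpose_matrix:
  fixes A :: "real^'n^'m"
  shows "x \<bullet> (A *v y) = (transpose A *v x) \<bullet> y"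
  by (simp add: dot_lmul_matrix)

lemma inner_symmetric_matrix:
  fixes A :: "real^'n^'n"
  assumes "transpose A = A"
  shows "x \<bullet> (A *v y) = (A *v x) \<bullet> y"
  using inner_transpose_matrix[of x A y] assms by simp

text \<open>The quadratic \<open>t \<mapsto> (x + t y) \<bullet> A (x + t y)\<close> is nonnegative, so its discriminant is not
  positive. The form may be degenerate, hence the separate case of a zero leading coefficient.\<close>

lemma psd_Cauchy_Schwarz:
  fixes A :: "real^'n^'n"
  assumes sym: "transpose A = A" and psd: "\<And>x. 0 \<le> x \<bullet> (A *v x)"
  shows "(x \<bullet> (A *v y))\<^sup>2 \<le> (x \<bullet> (A *v x)) * (y \<bullet> (A *v y))"
proof -
  define a b c where "a = x \<bullet> (A *v x)" and "b = x \<bullet> (A *v y)" and "c = y \<bullet> (A *v y)"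
  have "y \<bullet> (A *v x) = b"
    using inner_symmetric_matrix[OF sym, of y x] by (simp add: b_def inner_commute)
  then have q: "0 \<le> a + 2 * b * t + c * t\<^sup>2" for t
    using psd[of "x + t *\<^sub>R y"]
    by (simp add: a_def b_def c_def matrix_vector_right_distrib matrix_vector_mult_scaleR
        inner_add_left inner_add_right power2_eq_square algebra_simps)
  have "0 \<le> c"
    using psd c_def by simp
  have "b\<^sup>2 \<le> a * c"
  proof (cases "c = 0")
    case True
    have "b = 0"
    proof (rule ccontr)
      assume "b \<noteq> 0"
      \<comment> \<open>the point where the affine function \<open>a + 2 b t\<close> takes the value \<open>- 1\<close>\<close>
      with q[of "- (a + 1) / (2 * b)"] True show False
        by (simp add: field_simps)
    qed
    then show ?thesis
      using True by simp
  next
    case False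
    \<comment> \<open>the minimum of the quadratic\<close>
    with q[of "- b / c"] \<open>0 \<le> c\<close> show ?thesis
      by (simp add: field_simps power2_eq_square)
  qed
  then show ?thesis
    by (simp add: a_def b_def c_def)
qed

text \<open>Cauchy--Schwarz applied to \<open>A x\<close> and \<open>x\<close>. This is what turns injectivity of a limit of positive
  definite matrices into positive definiteness.\<close>

lemma psd_isotropic_imp_kernel:
  fixes A :: "real^'n^'n"
  assumes sym: "transpose A = A" and psd: "\<And>x. 0 \<le> x \<bullet> (A *v x)" and "x \<bullet> (A *v x) = 0"
  shows "A *v x = 0"
proof -
  have "((A *v x) \<bullet> (A *v x))\<^sup>2 \<le> 0"
    using psd_Cauchy_Schwarz[OF sym psd, of "A *v x" x] assms(3) by simp
  then show ?thesis
    by simp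
qed

lemma pos_def_matrix_nonneg:
  assumes "pos_def_matrix A"
  shows "0 \<le> x \<bullet> (A *v x)"
  using assms unfolding pos_def_matrix_def by (cases "x = 0") (auto simp: less_imp_le)

lemma pos_def_matrix_inj:
  assumes "pos_def_matrix A"
  shows "inj ((*v) A)"
proof -
  have "x = 0" if "A *v x = 0" for x
    using assms that unfolding pos_def_matrix_def by (metis inner_zero_right less_irrefl)
  then show ?thesis
    by (simp add: linear_injective_0)
qed

lemma pos_def_matrix_det_nz:
  assumes "pos_def_matrix A"
  shows "det A \<noteq> 0"
  using pos_def_matrix_inj[OF assms] det_nz_iff_inj[of "(*v) A"] by simp

lemma matrix_inv_vector_mult:
  fixes A :: "real^'n^'n"
  assumes "det A \<noteq> 0"
  shows "A *v (matrix_inv A *v x) = x" "matrix_inv A *v (A *v x) = x"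
proof -
  have "A ** matrix_inv A = mat 1 \<and> matrix_inv A ** A = mat 1"
    using assms unfolding invertible_det_nz[symmetric] invertible_def matrix_inv_def
    by (rule someI_ex[where P = "\<lambda>A'. A ** A' = mat 1 \<and> A' ** A = mat 1"])
  then show "A *v (matrix_inv A *v x) = x" "matrix_inv A *v (A *v x) = x"
    by (simp_all add: matrix_vector_mul_assoc)
qed

text \<open>Gram--Schmidt for the inner product \<open>x \<bullet> \<Phi> y\<close>: as long as the family does not span \<open>V\<close>, some
  vector of \<open>V\<close> has a nonzero component orthogonal to it, which is normalised and added.\<close>

lemma pos_def_orthonormal_family:
  fixes \<Phi> :: "real^'n^'n"
  assumes \<Phi>: "pos_def_matrix \<Phi>" and V: "subspace V" and "k \<le> dim V"
  shows "\<exists>B\<subseteq>V. finite B \<and> card B = k \<and> (\<forall>b\<in>B. b \<bullet> (\<Phi> *v b) = 1) \<and>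
    (\<forall>b\<in>B. \<forall>c\<in>B. b \<noteq> c \<longrightarrow> b \<bullet> (\<Phi> *v c) = 0)"
  using \<open>k \<le> dim V\<close>
proof (induction k)
  case 0
  show ?case
    by (intro exI[of _ "{}"]) simp
next
  case (Suc k)
  then obtain B where B: "B \<subseteq> V" "finite B" "card B = k" "\<And>b. b \<in> B \<Longrightarrow> b \<bullet> (\<Phi> *v b) = 1"
    "\<And>b c. b \<in> B \<Longrightarrow> c \<in> B \<Longrightarrow> b \<noteq> c \<Longrightarrow> b \<bullet> (\<Phi> *v c) = 0"
    using Suc_leD by auto
  have sym: "transpose \<Phi> = \<Phi>"
    using \<Phi> by (simp add: pos_def_matrix_def)
  have "dim B \<le> k"
    using dim_le_card'[OF B(2)] B(3) by simp
  then have "\<not> V \<subseteq> span B"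
    using Suc.prems dim_mono[of V B] by auto
  then obtain u where u: "u \<in> V" "u \<notin> span B"
    by blast
  define v where "v = u - (\<Sum>b\<in>B. (b \<bullet> (\<Phi> *v u)) *\<^sub>R b)"
  have sumV: "(\<Sum>b\<in>B. (b \<bullet> (\<Phi> *v u)) *\<^sub>R b) \<in> V"
    using B(1) V by (intro subspace_sum subspace_scale) auto
  have "(\<Sum>b\<in>B. (b \<bullet> (\<Phi> *v u)) *\<^sub>R b) \<in> span B"
    by (intro span_sum span_scale span_base)
  then have "v \<noteq> 0"
    using u by (auto simp: v_def)
  have "v \<in> V"
    unfolding v_def using u sumV V by (simp add: subspace_diff)
  have ortho: "c \<bullet> (\<Phi> *v v) = 0" if "c \<in> B" for c
  proof -
    have "c \<bullet> (\<Phi> *v (\<Sum>b\<in>B. (b \<bullet> (\<Phi> *v u)) *\<^sub>R b)) = (\<Sum>b\<in>B. (b \<bullet> (\<Phi> *v u)) * (c \<bullet> (\<Phi> *v b)))"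
      by (simp add: matrix_vector_mult_scaleR inner_sum_right linear_sum[OF matrix_vector_mul_linear])
    also have "\<dots> = (\<Sum>b\<in>B. if b = c then b \<bullet> (\<Phi> *v u) else 0)"
      using B that by (intro sum.cong) auto
    also have "\<dots> = c \<bullet> (\<Phi> *v u)"
      using that B by simp
    finally show ?thesis
      by (simp add: v_def matrix_vector_mult_diff_distrib inner_diff_right)
  qed
  define q where "q = v \<bullet> (\<Phi> *v v)"
  have "q > 0"
    using \<Phi> \<open>v \<noteq> 0\<close> by (simp add: q_def pos_def_matrix_def)
  define w where "w = (1 / sqrt q) *\<^sub>R v"
  have w1: "w \<bullet> (\<Phi> *v w) = 1"
    using \<open>q > 0\<close> by (simp add: w_def matrix_vector_mult_scaleR q_def[symmetric] real_sqrt_mult_self)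
  have wB: "c \<bullet> (\<Phi> *v w) = 0" "w \<bullet> (\<Phi> *v c) = 0" if "c \<in> B" for c
  proof -
    show "c \<bullet> (\<Phi> *v w) = 0"
      using ortho that by (simp add: w_def matrix_vector_mult_scaleR)
    then show "w \<bullet> (\<Phi> *v c) = 0"
      using inner_symmetric_matrix[OF sym, of w c] by (simp add: inner_commute)
  qed
  have "w \<notin> B"
    using w1 wB by force
  moreover have "w \<in> V"
    unfolding w_def using \<open>v \<in> V\<close> V by (simp add: subspace_scale)
  ultimately show ?case
    using B w1 wB by (intro exI[of _ "insert w B"]) auto
qed

lemma orthonormal_expansion:
  fixes E :: "'a::euclidean_space set"
  assumes "finite E" "pairwise orthogonal E" "\<And>e. e \<in> E \<Longrightarrow> norm e = 1" "u \<in> span E"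
  shows "(\<Sum>e\<in>E. (e \<bullet> u) *\<^sub>R e) = u"
proof -
  define d where "d = u - (\<Sum>e\<in>E. (e \<bullet> u) *\<^sub>R e)"
  have "orthogonal d c" if "c \<in> E" for c
  proof -
    have "(\<Sum>e\<in>E. (e \<bullet> u) *\<^sub>R e) \<bullet> c = (\<Sum>e\<in>E. if e = c then e \<bullet> u else 0)"
      unfolding inner_sum_left using that assms
      by (intro sum.cong) (auto simp: pairwise_def orthogonal_def dot_square_norm)
    then show ?thesis
      using that assms(1) by (simp add: d_def orthogonal_def inner_diff_left inner_commute[of u])
  qed
  moreover have "d \<in> span E"
    unfolding d_def by (intro span_diff span_sum span_scale assms(4) span_base)
  ultimately have "orthogonal d d"
    by (rule orthogonal_to_span[rotated])
  then show ?thesis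
    by (simp add: d_def orthogonal_self)
qed

text \<open>Here \<open>P\<close> is an orthogonal projection; let \<open>L\<close> be its kernel. For a vector \<open>Y\<close> with covariance
  \<open>\<Phi>\<close>, the vector \<open>W Y\<close> lies in \<open>L\<close>, is uncorrelated with \<open>P Y\<close> and is white on \<open>L\<close>. It is built from
  linear functionals \<open>x \<bullet> Y\<close> that are uncorrelated with \<open>P Y\<close>. Their coefficient vectors form the space
  \<open>V\<close> of all \<open>x\<close> with \<open>P \<Phi> x = 0\<close>, which \<open>\<Phi>\<close> maps onto \<open>L\<close>, so that a \<open>\<Phi>\<close>-orthonormal basis of \<open>V\<close> can be matched
  with an orthonormal basis of \<open>L\<close>.\<close>

lemma whitening_matrix:
  fixes \<Phi> P :: "real^'n^'n"
  assumes \<Phi>: "pos_def_matrix \<Phi>" and P: "transpose P = P" "P ** P = P"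
  obtains W where "P ** W = 0" "W ** \<Phi> ** P = 0" "W ** \<Phi> ** transpose W = mat 1 - P"
proof -
  have sym: "transpose \<Phi> = \<Phi>"
    using \<Phi> by (simp add: pos_def_matrix_def)
  define L where "L = {x. P *v x = 0}"
  define V where "V = {x. P *v (\<Phi> *v x) = 0}"
  have L: "subspace L" and V: "subspace V"
    unfolding L_def V_def subspace_def
    by (simp_all add: matrix_vector_right_distrib matrix_vector_mult_scaleR)
  have "(*v) \<Phi> ` V = L"
  proof
    show "L \<subseteq> (*v) \<Phi> ` V"
    proof
      fix x assume "x \<in> L"
      then show "x \<in> (*v) \<Phi> ` V"
        using matrix_inv_vector_mult[OF pos_def_matrix_det_nz[OF \<Phi>], of x]
        by (intro image_eqI[of _ _ "matrix_inv \<Phi> *v x"]) (auto simp: L_def V_def)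
    qed
  qed (auto simp: L_def V_def)
  then have dim: "dim V = dim L"
    using dim_image_eq[of "(*v) \<Phi>" V] inj_on_subset[OF pos_def_matrix_inj[OF \<Phi>]]
    by (metis matrix_vector_mul_linear subset_UNIV)
  obtain E where E: "E \<subseteq> L" "pairwise orthogonal E" "\<And>e. e \<in> E \<Longrightarrow> norm e = 1"
    "independent E" "card E = dim L" "span E = L"
    using orthonormal_basis_subspace[OF L] by metis
  have finE: "finite E"
    using E(4) by (simp add: independent_imp_finite)
  obtain B where B: "B \<subseteq> V" "finite B" "card B = dim L" "\<And>b. b \<in> B \<Longrightarrow> b \<bullet> (\<Phi> *v b) = 1"
    "\<And>b c. b \<in> B \<Longrightarrow> c \<in> B \<Longrightarrow> b \<noteq> c \<Longrightarrow> b \<bullet> (\<Phi> *v c) = 0"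
    using pos_def_orthonormal_family[OF \<Phi> V, of "dim L"] dim by auto
  obtain p where p: "bij_betw p E B"
    using finite_same_card_bij[OF finE B(2)] B(3) E(5) by auto
  have pB: "p e \<in> B" if "e \<in> E" for e
    using p that bij_betwE by blast
  have pp: "p e \<bullet> (\<Phi> *v p c) = (if e = c then 1 else 0)" if "e \<in> E" "c \<in> E" for e c
  proof (cases "e = c")
    case False
    then have "p e \<noteq> p c"
      using bij_betw_imp_inj_on[OF p] that by (auto dest: inj_onD)
    then show ?thesis
      using B(5) pB that False by simp
  qed (use B(4) pB that in simp)
  define f where "f y = (\<Sum>e\<in>E. (p e \<bullet> y) *\<^sub>R e)" for y
  have "linear f"
    unfolding f_def
    by (rule linearI) (simp_all add: inner_add_right scaleR_add_left sum.distrib scaleR_sum_right)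
  define W where "W = matrix f"
  have W: "W *v y = f y" for y
    using \<open>linear f\<close> by (simp add: W_def matrix_works)
  have WT: "transpose W *v x = (\<Sum>e\<in>E. (e \<bullet> x) *\<^sub>R p e)" for x
  proof (rule vector_eq_ldot[THEN iffD1], rule allI)
    fix y
    have "y \<bullet> (transpose W *v x) = (W *v y) \<bullet> x"
      using inner_transpose_matrix[of y "transpose W" x] by (simp only: transpose_transpose)
    also have "\<dots> = y \<bullet> (\<Sum>e\<in>E. (e \<bullet> x) *\<^sub>R p e)"
      by (simp add: W f_def inner_sum_left inner_sum_right inner_commute mult.commute)
    finally show "y \<bullet> (transpose W *v x) = y \<bullet> (\<Sum>e\<in>E. (e \<bullet> x) *\<^sub>R p e)" .
  qed
  have PE: "P *v e = 0" if "e \<in> E" for e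
    using that E(1) by (auto simp: L_def)
  show thesis
  proof
    show "P ** W = 0"
    proof (subst matrix_eq, rule allI)
      show "(P ** W) *v x = 0 *v x" for x
        by (simp add: matrix_vector_mul_assoc[symmetric] W f_def PE matrix_vector_mult_scaleR
            linear_sum[OF matrix_vector_mul_linear])
    qed
    show "W ** \<Phi> ** P = 0"
    proof (subst matrix_eq, rule allI)
      fix x
      have "p e \<bullet> (\<Phi> *v (P *v x)) = 0" if "e \<in> E" for e
      proof -
        have "p e \<bullet> (\<Phi> *v (P *v x)) = (P *v (\<Phi> *v p e)) \<bullet> x"
          by (simp only: inner_symmetric_matrix[OF sym] inner_symmetric_matrix[OF P(1)])
        also have "P *v (\<Phi> *v p e) = 0"
          using pB[OF that] B(1) by (auto simp: V_def)
        finally show ?thesis by simp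
      qed
      then show "(W ** \<Phi> ** P) *v x = 0 *v x"
        by (simp add: matrix_vector_mul_assoc[symmetric] W f_def)
    qed
    show "W ** \<Phi> ** transpose W = mat 1 - P"
    proof (subst matrix_eq, rule allI)
      fix x
      have "p e \<bullet> (\<Phi> *v (\<Sum>c\<in>E. (c \<bullet> x) *\<^sub>R p c)) = e \<bullet> (x - P *v x)" if "e \<in> E" for e
      proof -
        have "p e \<bullet> (\<Phi> *v (\<Sum>c\<in>E. (c \<bullet> x) *\<^sub>R p c)) = (\<Sum>c\<in>E. (c \<bullet> x) * (p e \<bullet> (\<Phi> *v p c)))"
          by (simp add: matrix_vector_mult_scaleR inner_sum_right linear_sum[OF matrix_vector_mul_linear])
        also have "\<dots> = (\<Sum>c\<in>E. if c = e then c \<bullet> x else 0)"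
          using that pp by (intro sum.cong) auto
        also have "\<dots> = e \<bullet> x"
          using that finE by simp
        also have "\<dots> = e \<bullet> (x - P *v x)"
          by (simp add: inner_diff_right inner_symmetric_matrix[OF P(1)] PE[OF that])
        finally show ?thesis .
      qed
      then have "(W ** \<Phi> ** transpose W) *v x = (\<Sum>e\<in>E. (e \<bullet> (x - P *v x)) *\<^sub>R e)"
        by (simp only: matrix_vector_mul_assoc[symmetric] W WT f_def) (intro sum.cong, simp_all)
      also have "\<dots> = x - P *v x"
      proof (rule orthonormal_expansion[OF finE E(2,3)])
        show "x - P *v x \<in> span E"
          unfolding E(6) L_def
          by (simp add: matrix_vector_mult_diff_distrib matrix_vector_mul_assoc P(2))
      qed
      finally show "(W ** \<Phi> ** transpose W) *v x = (mat 1 - P) *v x"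
        by (simp add: matrix_vector_mult_diff_rdistrib)
    qed
  qed
qed

text \<open>Whitening with \<open>P = 0\<close> gives \<open>W A W\<^sup>T = 1\<close>, so the determinant times a square is \<open>1\<close>.
  Positivity makes the square root in the Gaussian density a genuine one.\<close>

lemma pos_def_matrix_det_pos:
  fixes A :: "real^'a^'a"
  assumes "pos_def_matrix A"
  shows "det A > 0"
proof -
  have "transpose (0 :: real^'a^'a) = 0"
    by (simp add: transpose_def vec_eq_iff)
  moreover have "(0 :: real^'a^'a) ** 0 = (0 :: real^'a^'a)"
    by (simp add: matrix_matrix_mult_def vec_eq_iff)
  ultimately obtain W :: "real^'a^'a" where "W ** A ** transpose W = mat 1 - 0"
    using whitening_matrix[OF assms, of 0] by blast
  then have "det W * det A * det W = 1"
    using det_mul[of "W ** A" "transpose W"] by (simp add: det_mul)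
  then have "(det W)\<^sup>2 * det A = 1"
    by (simp add: power2_eq_square mult_ac)
  then show ?thesis
    by (metis zero_less_mult_iff zero_less_one zero_le_power2 not_less)
qed

lemma pos_def_matrix_congruence:
  fixes T \<Phi> :: "real^'n^'n"
  assumes "det T \<noteq> 0" "pos_def_matrix \<Phi>"
  shows "pos_def_matrix (T ** \<Phi> ** transpose T)"
  unfolding pos_def_matrix_def
proof (intro conjI allI impI)
  show "transpose (T ** \<Phi> ** transpose T) = T ** \<Phi> ** transpose T"
    using assms(2) by (simp add: pos_def_matrix_def matrix_transpose_mul matrix_mul_assoc)
  fix x :: "real^'n"
  assume "x \<noteq> 0"
  have "inj ((*v) (transpose T))"
    using assms(1) det_nz_iff_inj[of "(*v) (transpose T)"]
    by (metis det_transpose matrix_of_matrix_vector_mul matrix_vector_mul_linear)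
  then have "transpose T *v x \<noteq> 0"
    using \<open>x \<noteq> 0\<close> by (metis linear_injective_0 matrix_vector_mul_linear)
  then have "0 < (transpose T *v x) \<bullet> (\<Phi> *v (transpose T *v x))"
    using assms(2) unfolding pos_def_matrix_def by blast
  also have "\<dots> = x \<bullet> ((T ** \<Phi> ** transpose T) *v x)"
    by (simp only: matrix_vector_mul_assoc[symmetric] inner_transpose_matrix[of x T])
  finally show "0 < x \<bullet> ((T ** \<Phi> ** transpose T) *v x)" .
qed

section \<open>Compressions and limits of positive definite matrices\<close>

lemma symmetric_idempotent_inner:
  fixes P :: "real^'n^'n"
  assumes P: "transpose P = P" "P ** P = P"
  shows "x \<bullet> (P *v x) = (norm (P *v x))\<^sup>2" "x \<bullet> ((mat 1 - P) *v x) = (norm (x - P *v x))\<^sup>2"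
proof -
  have PP: "P *v (P *v x) = P *v x"
    by (simp add: matrix_vector_mul_assoc P(2))
  then show 1: "x \<bullet> (P *v x) = (norm (P *v x))\<^sup>2"
    using inner_symmetric_matrix[OF P(1), of x "P *v x"] by (simp add: dot_square_norm)
  then show "x \<bullet> ((mat 1 - P) *v x) = (norm (x - P *v x))\<^sup>2"
    by (simp add: matrix_vector_mult_diff_rdistrib dot_square_norm[symmetric] inner_diff_left
        inner_diff_right inner_commute)
qed

lemma inner_compression:
  fixes \<Phi> P :: "real^'n^'n"
  assumes "transpose P = P"
  shows "x \<bullet> ((P ** \<Phi> ** P) *v y) = (P *v x) \<bullet> (\<Phi> *v (P *v y))"
  using inner_symmetric_matrix[OF assms] by (simp add: matrix_vector_mul_assoc[symmetric])

lemma transpose_compression: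
  fixes \<Phi> P :: "real^'n^'n"
  assumes "transpose P = P" "transpose \<Phi> = \<Phi>"
  shows "transpose (P ** \<Phi> ** P) = P ** \<Phi> ** P"
  using assms by (simp add: matrix_transpose_mul matrix_mul_assoc)

lemma matrix_add_rdistrib: "(A + B) ** C = A ** C + B ** (C :: real^'k^'n)"
  by (simp add: matrix_matrix_mult_def vec_eq_iff distrib_right sum.distrib)

lemma transpose_add: "transpose (A + B) = transpose A + transpose (B :: real^'n^'m)"
  by (simp add: transpose_def vec_eq_iff)

lemma transpose_diff: "transpose (A - B) = transpose A - transpose (B :: real^'n^'m)"
  by (simp add: transpose_def vec_eq_iff)

text \<open>The compression is positive definite on the range of \<open>P\<close>, and \<open>1 - P\<close> is the identity on the
  kernel of \<open>P\<close>, its orthogonal complement.\<close>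

lemma pos_def_compression:
  fixes \<Phi> P :: "real^'n^'n"
  assumes \<Phi>: "pos_def_matrix \<Phi>" and P: "transpose P = P" "P ** P = P"
  shows "pos_def_matrix (P ** \<Phi> ** P + (mat 1 - P))"
  unfolding pos_def_matrix_def
proof (intro conjI allI impI)
  show "transpose (P ** \<Phi> ** P + (mat 1 - P)) = P ** \<Phi> ** P + (mat 1 - P)"
    using \<Phi> by (simp add: transpose_add transpose_diff transpose_compression P pos_def_matrix_def)
  fix x :: "real^'n"
  assume "x \<noteq> 0"
  have eq: "x \<bullet> ((P ** \<Phi> ** P + (mat 1 - P)) *v x)
      = (P *v x) \<bullet> (\<Phi> *v (P *v x)) + (norm (x - P *v x))\<^sup>2"
    by (simp add: matrix_vector_mult_add_rdistrib inner_add_right inner_compression[OF P(1)]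
        symmetric_idempotent_inner[OF P])
  show "0 < x \<bullet> ((P ** \<Phi> ** P + (mat 1 - P)) *v x)"
  proof (cases "P *v x = 0")
    case True
    then show ?thesis
      unfolding eq using \<open>x \<noteq> 0\<close> by simp
  next
    case False
    then have "0 < (P *v x) \<bullet> (\<Phi> *v (P *v x))"
      using \<Phi> by (simp add: pos_def_matrix_def)
    then show ?thesis
      unfolding eq by (simp add: add_pos_nonneg)
  qed
qed

lemma tendsto_matrix_vector_mult:
  fixes S :: "nat \<Rightarrow> real^'n^'m"
  assumes "S \<longlonglongrightarrow> A"
  shows "(\<lambda>m. S m *v x) \<longlonglongrightarrow> A *v x"
proof (rule vec_tendstoI)
  show "(\<lambda>m. (S m *v x) $ i) \<longlonglongrightarrow> (A *v x) $ i" for i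
    unfolding matrix_vector_mult_def
    by (simp, intro tendsto_intros tendsto_vec_nth assms)
qed

lemma psd_limit:
  fixes S :: "nat \<Rightarrow> real^'n^'n"
  assumes S: "S \<longlonglongrightarrow> A" and sym: "\<And>m. transpose (S m) = S m"
    and psd: "\<And>m x. 0 \<le> x \<bullet> (S m *v x)"
  shows "transpose A = A" "0 \<le> x \<bullet> (A *v x)"
proof -
  have "A $ i $ j = A $ j $ i" for i j
  proof (rule LIMSEQ_unique)
    show "(\<lambda>m. S m $ i $ j) \<longlonglongrightarrow> A $ i $ j"
      by (intro tendsto_vec_nth S)
    have "S m $ i $ j = S m $ j $ i" for m
      using sym[of m] by (simp add: transpose_def vec_eq_iff)
    then show "(\<lambda>m. S m $ i $ j) \<longlonglongrightarrow> A $ j $ i"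
      by (simp, intro tendsto_vec_nth S)
  qed
  then show "transpose A = A"
    by (simp add: transpose_def vec_eq_iff)
  show "0 \<le> x \<bullet> (A *v x)"
    by (rule tendsto_lowerbound[of "\<lambda>m. x \<bullet> (S m *v x)" _ sequentially])
      (simp_all add: psd tendsto_inner tendsto_matrix_vector_mult[OF S])
qed

lemma pos_def_limit_nonsingular:
  fixes S :: "nat \<Rightarrow> real^'n^'n"
  assumes S: "S \<longlonglongrightarrow> A" "\<And>m. pos_def_matrix (S m)" and det: "det A \<noteq> 0"
  shows "pos_def_matrix A"
proof -
  have A: "transpose A = A" "0 \<le> x \<bullet> (A *v x)" for x
  proof -
    have 1: "transpose (S m) = S m" for m
      using S(2)[of m] by (simp add: pos_def_matrix_def)
    show "transpose A = A" "0 \<le> x \<bullet> (A *v x)"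
      by (rule psd_limit[OF S(1) 1 pos_def_matrix_nonneg[OF S(2)]])+
  qed
  have "0 < x \<bullet> (A *v x)" if "x \<noteq> 0" for x
  proof -
    have "A *v x \<noteq> 0"
      using matrix_inv_vector_mult(2)[OF det, of x] that by force
    then show ?thesis
      using psd_isotropic_imp_kernel[OF A, of x] A(2)[of x] by linarith
  qed
  then show ?thesis
    using A(1) by (simp add: pos_def_matrix_def)
qed

text \<open>The limit \<open>D\<close> of the compressions is positive semidefinite, and injectivity on the range of \<open>P\<close>
  excludes isotropic vectors there.\<close>

lemma pos_def_limit_compression:
  fixes S :: "nat \<Rightarrow> real^'n^'n"
  assumes S: "\<And>m. pos_def_matrix (S m)" "(\<lambda>m. P ** S m ** P) \<longlonglongrightarrow> D"
    and P: "transpose P = P" "P ** P = P" and inj: "inj_on (\<lambda>x. D *v x) {x. P *v x = x}"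
  shows "pos_def_matrix (D + (mat 1 - P))"
  unfolding pos_def_matrix_def
proof (intro conjI allI impI)
  have D: "transpose D = D" "0 \<le> x \<bullet> (D *v x)" for x
  proof -
    have 1: "transpose (P ** S m ** P) = P ** S m ** P" for m
      using S(1)[of m] by (simp add: transpose_compression P(1) pos_def_matrix_def)
    have 2: "0 \<le> x \<bullet> ((P ** S m ** P) *v x)" for m x
      by (simp add: inner_compression[OF P(1)] pos_def_matrix_nonneg[OF S(1)])
    show "transpose D = D" "0 \<le> x \<bullet> (D *v x)"
      by (rule psd_limit[OF S(2) 1 2])+
  qed
  show "transpose (D + (mat 1 - P)) = D + (mat 1 - P)"
    by (simp add: transpose_add transpose_diff P D(1))
  fix x :: "real^'n"
  assume "x \<noteq> 0"
  have eq: "x \<bullet> ((D + (mat 1 - P)) *v x) = x \<bullet> (D *v x) + (norm (x - P *v x))\<^sup>2"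
    by (simp add: matrix_vector_mult_add_rdistrib inner_add_right symmetric_idempotent_inner[OF P])
  show "0 < x \<bullet> ((D + (mat 1 - P)) *v x)"
  proof (cases "P *v x = x")
    case False
    then show ?thesis
      unfolding eq using D(2)[of x] by (simp add: add_nonneg_pos)
  next
    case True
    have "D *v x \<noteq> D *v 0"
      using inj_onD[OF inj, of x 0] True \<open>x \<noteq> 0\<close> by auto
    then have "x \<bullet> (D *v x) \<noteq> 0"
      using psd_isotropic_imp_kernel[OF D] by auto
    then show ?thesis
      unfolding eq using D(2)[of x] True by simp
  qed
qed

section \<open>Gaussian integrals under linear substitutions\<close>

definition gaussian_density :: "real^'n^'n \<Rightarrow> real^'n \<Rightarrow> real" where
  "gaussian_density \<Phi> y =
     exp (- (y \<bullet> (matrix_inv \<Phi> *v y)) / 2) / sqrt ((2 * pi) ^ CARD('n) * det \<Phi>)"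

lemma borel_measurable_gaussian_density [measurable]:
  "gaussian_density \<Phi> \<in> borel_measurable borel"
  unfolding gaussian_density_def by measurable

lemma gaussian_density_nonneg:
  "pos_def_matrix \<Phi> \<Longrightarrow> 0 \<le> gaussian_density \<Phi> y"
  by (simp add: gaussian_density_def pos_def_matrix_det_pos less_imp_le)

lemma integral_lborel_translation:
  fixes f :: "'a::euclidean_space \<Rightarrow> real"
  assumes [measurable]: "f \<in> borel_measurable borel"
  shows "(\<integral>y. f (c + y) \<partial>lborel) = (\<integral>y. f y \<partial>lborel)"
proof -
  have "(\<integral>y. f y \<partial>lborel) = (\<integral>y. f y \<partial>distr lborel borel ((+) c))"
    by (simp add: lborel_distr_plus)
  then show ?thesis
    by (simp add: integral_distr)
qed

lemma integral_gaussian_measure: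
  fixes f :: "real^'n \<Rightarrow> real"
  assumes [measurable]: "f \<in> borel_measurable borel" and \<Phi>: "pos_def_matrix \<Phi>"
  shows "(\<integral>y. f y \<partial>gaussian_measure \<mu> \<Phi>) = (\<integral>y. gaussian_density \<Phi> y * f (\<mu> + y) \<partial>lborel)"
proof -
  have "gaussian_measure \<mu> \<Phi> = density lborel (\<lambda>y. ennreal (gaussian_density \<Phi> (y - \<mu>)))"
    by (simp add: gaussian_measure_def gaussian_density_def)
  then have "(\<integral>y. f y \<partial>gaussian_measure \<mu> \<Phi>) = (\<integral>y. gaussian_density \<Phi> (y - \<mu>) * f y \<partial>lborel)"
    by (simp add: integral_density gaussian_density_nonneg[OF \<Phi>])
  also have "\<dots> = (\<integral>y. gaussian_density \<Phi> (\<mu> + y - \<mu>) * f (\<mu> + y) \<partial>lborel)"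
    by (rule integral_lborel_translation[symmetric]) measurable
  finally show ?thesis
    by simp
qed

text \<open>The quadratic form in the exponent is invariant, and the Jacobian \<open>\<bar>det T\<bar>\<close> cancels against the
  square root of \<open>det (T \<Phi> T\<^sup>T) = (det T)\<^sup>2 det \<Phi>\<close>.\<close>

lemma gaussian_density_congruence:
  fixes T \<Phi> :: "real^'n^'n"
  assumes T: "det T \<noteq> 0" and \<Phi>: "pos_def_matrix \<Phi>"
  shows "\<bar>det T\<bar> * gaussian_density (T ** \<Phi> ** transpose T) (T *v x) = gaussian_density \<Phi> x"
proof -
  let ?\<Psi> = "T ** \<Phi> ** transpose T"
  define z where "z = matrix_inv ?\<Psi> *v (T *v x)"
  have det: "det ?\<Psi> = (det T)\<^sup>2 * det \<Phi>"
    by (simp add: det_mul power2_eq_square)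
  then have "det ?\<Psi> \<noteq> 0"
    using T pos_def_matrix_det_nz[OF \<Phi>] by simp
  then have "T *v (\<Phi> *v (transpose T *v z)) = T *v x"
    using matrix_inv_vector_mult(1)[of ?\<Psi> "T *v x"] unfolding z_def[symmetric]
    by (simp add: matrix_vector_mul_assoc matrix_mul_assoc del: transpose_matrix_vector)
  then have "\<Phi> *v (transpose T *v z) = x"
    using T matrix_inv_vector_mult(2)[of T] by metis
  then have "transpose T *v z = matrix_inv \<Phi> *v x"
    using matrix_inv_vector_mult(2)[OF pos_def_matrix_det_nz[OF \<Phi>]] by metis
  then have "(T *v x) \<bullet> z = x \<bullet> (matrix_inv \<Phi> *v x)"
    using inner_transpose_matrix[of z T x] by (simp add: inner_commute)
  then show ?thesis
    using T pos_def_matrix_det_pos[OF \<Phi>]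
    by (simp add: gaussian_density_def z_def[symmetric] det real_sqrt_mult field_simps)
qed

text \<open>If \<open>Y\<close> is centred Gaussian with covariance \<open>\<Phi>\<close>, then \<open>T Y\<close> is so with covariance \<open>T \<Phi> T\<^sup>T\<close>.\<close>

lemma gaussian_integral_congruence:
  fixes T \<Phi> :: "real^'n^'n" and f :: "real^'n \<Rightarrow> real"
  assumes T: "det T \<noteq> 0" and \<Phi>: "pos_def_matrix \<Phi>" and [measurable]: "f \<in> borel_measurable borel"
  shows "(\<integral>y. gaussian_density (T ** \<Phi> ** transpose T) y * f y \<partial>lborel)
    = (\<integral>y. gaussian_density \<Phi> y * f (T *v y) \<partial>lborel)"
  by (subst integral_linear_change_of_variables[OF T])
    (simp_all add: mult.assoc[symmetric] gaussian_density_congruence[OF T \<Phi>])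

lemma integrable_exp_minus_square_real:
  assumes "c > 0"
  shows "integrable lborel (\<lambda>t::real. exp (- c * t\<^sup>2))"
proof -
  define s where "s = 1 / sqrt (2 * c)"
  have s2: "s\<^sup>2 = 1 / (2 * c)"
    using assms by (simp add: s_def power_divide)
  have "exp (- c * t\<^sup>2) = sqrt (2 * pi * s\<^sup>2) * normal_density 0 s t" for t
    using assms by (simp add: normal_density_def s2 field_simps)
  moreover have "integrable lborel (normal_density 0 s)"
    using assms by (intro integrable_normal_density) (simp add: s_def)
  ultimately show ?thesis
    by simp
qed

text \<open>The exponential of a sum of squares is a product of one-dimensional normal densities, up to a
  constant.\<close>

lemma integrable_exp_minus_norm_square:
  assumes "c > 0"
  shows "integrable lborel (\<lambda>y :: 'a::euclidean_space. exp (- c * (norm y)\<^sup>2))"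
proof -
  interpret product_sigma_finite "\<lambda>_ :: 'a. lborel :: real measure" ..
  have "(norm (\<Sum>b\<in>Basis. y b *\<^sub>R b :: 'a))\<^sup>2 = (\<Sum>b\<in>Basis. (y b)\<^sup>2)" for y
  proof -
    have "(norm x)\<^sup>2 = (\<Sum>b\<in>Basis. (x \<bullet> b)\<^sup>2)" for x :: 'a
      by (simp add: norm_eq_sqrt_inner euclidean_inner[of x x] power2_eq_square sum_nonneg)
    then show ?thesis
      by simp
  qed
  then have "exp (- c * (norm (\<Sum>b\<in>Basis. y b *\<^sub>R b :: 'a))\<^sup>2) = (\<Prod>b\<in>Basis. exp (- c * (y b)\<^sup>2))" for y
    by (simp add: exp_sum[symmetric] sum_distrib_left)
  moreover have "integrable (Pi\<^sub>M (Basis :: 'a set) (\<lambda>_. lborel)) (\<lambda>y. \<Prod>b\<in>Basis. exp (- c * (y b)\<^sup>2))"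
    by (rule product_integrable_prod) (use integrable_exp_minus_square_real[OF assms] in auto)
  ultimately show ?thesis
    by (subst lborel_eq) (simp add: integrable_distr_eq)
qed

section \<open>Continuity of Gaussian expectations in the covariance matrix\<close>

lemma tendsto_det:
  fixes S :: "nat \<Rightarrow> real^'n^'n"
  assumes "\<And>i j. (\<lambda>m. S m $ i $ j) \<longlonglongrightarrow> A $ i $ j"
  shows "(\<lambda>m. det (S m)) \<longlonglongrightarrow> det A"
  unfolding det_def by (intro tendsto_sum tendsto_mult tendsto_prod tendsto_const assms)

text \<open>Cramer's rule exhibits the inverse as a quotient of polynomials in the entries.\<close>

lemma tendsto_matrix_inv_vector:
  fixes S :: "nat \<Rightarrow> real^'n^'n"
  assumes "S \<longlonglongrightarrow> A" "\<And>m. det (S m) \<noteq> 0" "det A \<noteq> 0"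
  shows "(\<lambda>m. matrix_inv (S m) *v b) \<longlonglongrightarrow> matrix_inv A *v b"
proof -
  have inv: "matrix_inv B *v b = (\<chi> k. det (\<chi> i j. if j = k then b $ i else B $ i $ j) / det B)"
    if "det B \<noteq> 0" for B :: "real^'n^'n"
    using cramer[OF that] matrix_inv_vector_mult(1)[OF that] by blast
  have S: "(\<lambda>m. S m $ i $ j) \<longlonglongrightarrow> A $ i $ j" for i j
    using assms(1) by (intro tendsto_vec_nth)
  show ?thesis
    unfolding inv[OF assms(2)] inv[OF assms(3)]
  proof (rule vec_tendstoI)
    fix k
    have "(\<lambda>m. det (\<chi> i j. if j = k then b $ i else S m $ i $ j) / det (S m))
       \<longlonglongrightarrow> det (\<chi> i j. if j = k then b $ i else A $ i $ j) / det A"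
      using S assms(3) by (intro tendsto_divide tendsto_det) (auto intro!: tendsto_eq_intros)
    then show "(\<lambda>m. (\<chi> k. det (\<chi> i j. if j = k then b $ i else S m $ i $ j) / det (S m)) $ k)
       \<longlonglongrightarrow> (\<chi> k. det (\<chi> i j. if j = k then b $ i else A $ i $ j) / det A) $ k"
      by simp
  qed
qed

lemma norm_matrix_vector_mult_le:
  fixes A :: "real^'n^'m"
  shows "norm (A *v x) \<le> norm A * norm x"
proof -
  have "norm (A *v x) = L2_set (\<lambda>i. norm ((A *v x) $ i)) UNIV"
    by (simp add: norm_vec_def)
  also have "\<dots> \<le> L2_set (\<lambda>i. norm (A $ i) * norm x) UNIV"
    by (intro L2_set_mono) (auto simp: matrix_vector_mul_component Cauchy_Schwarz_ineq2)
  also have "\<dots> = norm A * norm x"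
    by (simp add: L2_set_left_distrib norm_vec_def)
  finally show ?thesis .
qed

text \<open>A bound from above on the covariance gives a decay rate of the density that depends only
  on the bound. With \<open>z = \<Phi>\<^sup>-\<^sup>1 x\<close> it follows from Cauchy--Schwarz for \<open>\<Phi>\<close>:
  \<open>\<bar>x\<bar>\<^sup>4 = (x \<bullet> \<Phi> z)\<^sup>2 \<le> (x \<bullet> \<Phi> x) (z \<bullet> \<Phi> z) \<le> K \<bar>x\<bar>\<^sup>2 (x \<bullet> z)\<close>.\<close>

lemma pos_def_inverse_lower_bound:
  fixes \<Phi> :: "real^'n^'n"
  assumes \<Phi>: "pos_def_matrix \<Phi>" and "norm \<Phi> \<le> K" "K > 0"
  shows "(norm x)\<^sup>2 / K \<le> x \<bullet> (matrix_inv \<Phi> *v x)"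
proof (cases "x = 0")
  case False
  define z where "z = matrix_inv \<Phi> *v x"
  have z: "\<Phi> *v z = x"
    unfolding z_def by (rule matrix_inv_vector_mult[OF pos_def_matrix_det_nz[OF \<Phi>]])
  have "((norm x)\<^sup>2)\<^sup>2 = (x \<bullet> (\<Phi> *v z))\<^sup>2"
    by (simp add: z dot_square_norm)
  also have "\<dots> \<le> (x \<bullet> (\<Phi> *v x)) * (z \<bullet> (\<Phi> *v z))"
    using \<Phi> pos_def_matrix_nonneg[OF \<Phi>] by (intro psd_Cauchy_Schwarz) (auto simp: pos_def_matrix_def)
  also have "\<dots> \<le> (K * (norm x)\<^sup>2) * (z \<bullet> (\<Phi> *v z))"
  proof (intro mult_right_mono pos_def_matrix_nonneg[OF \<Phi>])
    have "x \<bullet> (\<Phi> *v x) \<le> norm x * norm (\<Phi> *v x)"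
      by (rule norm_cauchy_schwarz)
    also have "\<dots> \<le> norm x * (K * norm x)"
      using norm_matrix_vector_mult_le[of \<Phi> x] mult_right_mono[OF assms(2) norm_ge_zero[of x]]
      by (intro mult_left_mono) auto
    finally show "x \<bullet> (\<Phi> *v x) \<le> K * (norm x)\<^sup>2"
      by (simp add: power2_eq_square mult_ac)
  qed
  also have "z \<bullet> (\<Phi> *v z) = x \<bullet> z"
    by (simp add: z inner_commute)
  finally have "(norm x)\<^sup>2 * (norm x)\<^sup>2 \<le> (norm x)\<^sup>2 * (K * (x \<bullet> z))"
    by (simp add: power2_eq_square mult_ac)
  then have "(norm x)\<^sup>2 \<le> K * (x \<bullet> z)"
    by (rule mult_left_le_imp_le) (use False in simp)
  then show ?thesis
    using assms(3) by (simp add: z_def field_simps)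
qed simp

text \<open>Dominated convergence: a convergent sequence of covariances is bounded, which bounds the
  exponential factors by one integrable Gaussian, and the determinants converge to a positive number,
  which bounds the normalising factors \<open>k\<close>.\<close>

lemma gaussian_integral_tendsto:
  fixes S :: "nat \<Rightarrow> real^'n^'n" and f :: "real^'n \<Rightarrow> real"
  assumes S: "\<And>m. pos_def_matrix (S m)" "S \<longlonglongrightarrow> \<Phi>" and \<Phi>: "pos_def_matrix \<Phi>"
    and [measurable]: "f \<in> borel_measurable borel" and f: "\<And>y. 0 \<le> f y" "\<And>y. f y \<le> 1"
  shows "(\<lambda>m. \<integral>y. gaussian_density (S m) y * f y \<partial>lborel)
    \<longlonglongrightarrow> (\<integral>y. gaussian_density \<Phi> y * f y \<partial>lborel)"
proof -
  note nz = pos_def_matrix_det_nz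
  define k :: "real^'n^'n \<Rightarrow> real" where "k A = 1 / sqrt ((2 * pi) ^ CARD('n) * det A)" for A
  have k: "(\<lambda>m. k (S m)) \<longlonglongrightarrow> k \<Phi>"
    unfolding k_def using pos_def_matrix_det_pos[OF \<Phi>]
    by (intro tendsto_intros tendsto_det tendsto_vec_nth S) auto
  obtain K where K: "\<And>m. norm (k (S m)) \<le> K"
    using convergent_imp_Bseq[OF convergentI[OF k]] unfolding Bseq_def by auto
  obtain B where B: "B > 0" "\<And>m. norm (S m) \<le> B"
    using convergent_imp_Bseq[OF convergentI[OF S(2)]] unfolding Bseq_def by auto
  have gd: "gaussian_density A y = exp (- (y \<bullet> (matrix_inv A *v y)) / 2) * k A" for A :: "real^'n^'n" and y
    by (simp add: gaussian_density_def k_def)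
  show ?thesis
  proof (rule integral_dominated_convergence[where w = "\<lambda>y. K * exp (- (1 / (2 * B)) * (norm y)\<^sup>2)"])
    show "integrable lborel (\<lambda>y::real^'n. K * exp (- (1 / (2 * B)) * (norm y)\<^sup>2))"
      using B(1) by (intro integrable_mult_right integrable_exp_minus_norm_square) auto
    show "AE y in lborel. (\<lambda>m. gaussian_density (S m) y * f y) \<longlonglongrightarrow> gaussian_density \<Phi> y * f y"
      unfolding gd using nz[OF S(1)] nz[OF \<Phi>] S(2) k
      by (intro AE_I2 tendsto_intros tendsto_matrix_inv_vector) auto
    show "AE y in lborel. norm (gaussian_density (S m) y * f y) \<le> K * exp (- (1 / (2 * B)) * (norm y)\<^sup>2)" for m
    proof (rule AE_I2)
      fix y :: "real^'n"
      have "exp (- (y \<bullet> (matrix_inv (S m) *v y)) / 2) \<le> exp (- (1 / (2 * B)) * (norm y)\<^sup>2)"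
        using pos_def_inverse_lower_bound[OF S(1)[of m] B(2) B(1), of y] by simp
      moreover have "norm (gaussian_density (S m) y * f y)
          = exp (- (y \<bullet> (matrix_inv (S m) *v y)) / 2) * (norm (k (S m)) * f y)"
        using f by (simp add: gd abs_mult)
      moreover have "norm (k (S m)) * f y \<le> K * 1"
        using K[of m] f[of y] norm_ge_zero[of "k (S m)"] by (intro mult_mono) auto
      moreover have "0 \<le> norm (k (S m)) * f y"
        using f by simp
      ultimately show "norm (gaussian_density (S m) y * f y) \<le> K * exp (- (1 / (2 * B)) * (norm y)\<^sup>2)"
        by (metis mult.commute mult_mono exp_ge_zero mult.right_neutral)
    qed
  qed measurable
qed

lemma gaussian_expectation_tendsto:
  fixes f :: "real^'n \<Rightarrow> real"
  assumes S: "\<And>m. pos_def_matrix (S m)" "S \<longlonglongrightarrow> \<Phi>" and \<Phi>: "pos_def_matrix \<Phi>"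
    and [measurable]: "f \<in> borel_measurable borel" and f: "\<And>y. 0 \<le> f y" "\<And>y. f y \<le> 1"
  shows "(\<lambda>m. \<integral>y. f y \<partial>gaussian_measure \<mu> (S m)) \<longlonglongrightarrow> (\<integral>y. f y \<partial>gaussian_measure \<mu> \<Phi>)"
  using gaussian_integral_tendsto[OF S \<Phi>, of "\<lambda>y. f (\<mu> + y)"] f
  by (simp add: integral_gaussian_measure S(1) \<Phi>)

section \<open>Invariant functions\<close>

text \<open>The map \<open>y \<mapsto> \<surd>v (y - \<mu>\<^sub>0) + \<mu>\<close> of the group carries the Gaussian measure on the right to the one
  on the left, and Gaussian measures do not charge the exceptional null set. So for invariant functions
  mean and scale are irrelevant.\<close>

lemma gaussian_integral_invariance_group:
  fixes f :: "real^'n \<Rightarrow> real"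
  assumes inv: "almost_invariant (invariance_group M) f" and M: "\<mu> \<in> M" "\<mu>\<^sub>0 \<in> M"
    and v: "v > 0" and \<Phi>: "pos_def_matrix \<Phi>" and [measurable]: "f \<in> borel_measurable borel"
  shows "(\<integral>y. f y \<partial>gaussian_measure \<mu> (v *\<^sub>R \<Phi>)) = (\<integral>y. f y \<partial>gaussian_measure \<mu>\<^sub>0 \<Phi>)"
proof -
  define T :: "real^'n^'n" where "T = sqrt v *\<^sub>R mat 1"
  have Tv: "T *v x = sqrt v *\<^sub>R x" for x
    by (simp add: T_def scaleR_matrix_vector_assoc[symmetric])
  have "inj ((*v) T)"
    using v by (simp add: Tv inj_on_def)
  then have T: "det T \<noteq> 0"
    using det_nz_iff_inj[of "(*v) T"] by simp
  have "transpose T = T"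
    by (simp add: T_def transpose_def vec_eq_iff mat_def)
  then have T\<Phi>: "T ** \<Phi> ** transpose T = v *\<^sub>R \<Phi>"
    using v by (simp add: matrix_eq matrix_vector_mul_assoc[symmetric] Tv matrix_vector_mult_scaleR
        scaleR_matrix_vector_assoc[symmetric])
  then have v\<Phi>: "pos_def_matrix (v *\<^sub>R \<Phi>)"
    using pos_def_matrix_congruence[OF T \<Phi>] by simp
  have ae: "AE y in lborel. f (\<mu> + sqrt v *\<^sub>R y) = f (\<mu>\<^sub>0 + y)"
  proof -
    have "(\<lambda>y. sqrt v *\<^sub>R (y - \<mu>\<^sub>0) + \<mu>) \<in> invariance_group M"
      unfolding invariance_group_def using v M
      by (intro CollectI exI[of _ "sqrt v"] exI[of _ \<mu>\<^sub>0] exI[of _ \<mu>]) simp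
    then obtain N where N: "N \<in> null_sets lborel"
      "\<And>y. y \<notin> N \<Longrightarrow> f (sqrt v *\<^sub>R (y - \<mu>\<^sub>0) + \<mu>) = f y"
      using inv unfolding almost_invariant_def by metis
    have "AE y in distr lborel borel ((+) \<mu>\<^sub>0). y \<notin> N"
      using AE_not_in[OF N(1)] by (subst lborel_distr_plus)
    then have "AE y in lborel. \<mu>\<^sub>0 + y \<notin> N"
      by (rule AE_distrD[rotated]) simp
    then show ?thesis
      by eventually_elim (use N(2) in \<open>force simp: add.commute\<close>)
  qed
  have "(\<integral>y. f y \<partial>gaussian_measure \<mu> (v *\<^sub>R \<Phi>)) = (\<integral>y. gaussian_density (v *\<^sub>R \<Phi>) y * f (\<mu> + y) \<partial>lborel)"
    by (intro integral_gaussian_measure v\<Phi>) measurable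
  also have "\<dots> = (\<integral>y. gaussian_density \<Phi> y * f (\<mu> + sqrt v *\<^sub>R y) \<partial>lborel)"
    using gaussian_integral_congruence[OF T \<Phi>, of "\<lambda>y. f (\<mu> + y)"] by (simp add: T\<Phi> Tv)
  also have "\<dots> = (\<integral>y. gaussian_density \<Phi> y * f (\<mu>\<^sub>0 + y) \<partial>lborel)"
    using ae by (intro integral_cong_AE) auto
  also have "\<dots> = (\<integral>y. f y \<partial>gaussian_measure \<mu>\<^sub>0 \<Phi>)"
    by (rule integral_gaussian_measure[OF _ \<Phi>, symmetric]) simp
  finally show ?thesis .
qed

text \<open>A function invariant under translations by the kernel \<open>L\<close> of \<open>P\<close> sees a random vector \<open>Y\<close> only through \<open>P Y\<close>, so the
  \<open>L\<close>-part of the covariance may be replaced at will. Concretely, \<open>T = P + W\<close> with \<open>W\<close> whitening on \<open>L\<close>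
  moves each point by an element of \<open>L\<close> and makes the covariance block diagonal with identity on \<open>L\<close>.\<close>

lemma gaussian_integral_compression:
  fixes f :: "real^'n \<Rightarrow> real"
  assumes \<Phi>: "pos_def_matrix \<Phi>" and P: "transpose P = P" "P ** P = P"
    and [measurable]: "f \<in> borel_measurable borel"
    and inv: "\<And>x z. P *v z = 0 \<Longrightarrow> f (x + z) = f x"
  shows "(\<integral>y. f y \<partial>gaussian_measure \<mu> \<Phi>)
    = (\<integral>y. f y \<partial>gaussian_measure \<mu> (P ** \<Phi> ** P + (mat 1 - P)))"
proof -
  let ?\<Psi> = "P ** \<Phi> ** P + (mat 1 - P)"
  have \<Psi>: "pos_def_matrix ?\<Psi>"
    by (rule pos_def_compression[OF \<Phi> P])
  obtain W where W: "P ** W = 0" "W ** \<Phi> ** P = 0" "W ** \<Phi> ** transpose W = mat 1 - P"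
    using whitening_matrix[OF \<Phi> P] by blast
  define T where "T = P + W"
  have "transpose \<Phi> = \<Phi>"
    using \<Phi> by (simp add: pos_def_matrix_def)
  then have "P ** \<Phi> ** transpose W = transpose (W ** \<Phi> ** P)"
    by (simp add: matrix_transpose_mul P(1) matrix_mul_assoc)
  also have "\<dots> = 0"
    unfolding W(2) by (simp add: transpose_def vec_eq_iff)
  finally have T\<Phi>: "T ** \<Phi> ** transpose T = ?\<Psi>"
    by (simp add: T_def transpose_add P(1) matrix_add_ldistrib matrix_add_rdistrib W(2,3))
  have "det (T ** \<Phi> ** transpose T) \<noteq> 0"
    unfolding T\<Phi> by (rule pos_def_matrix_det_nz[OF \<Psi>])
  then have T: "det T \<noteq> 0"
    by (auto simp: det_mul)
  have fT: "f (\<mu> + T *v y) = f (\<mu> + y)" for y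
  proof -
    have "P *v (T *v y - y) = 0"
      by (simp add: T_def matrix_vector_mult_add_rdistrib matrix_vector_mult_diff_distrib
          matrix_vector_right_distrib matrix_vector_mul_assoc P(2) W(1))
    from inv[OF this, of "\<mu> + y"] show ?thesis
      by simp
  qed
  have "(\<integral>y. f y \<partial>gaussian_measure \<mu> ?\<Psi>) = (\<integral>y. gaussian_density ?\<Psi> y * f (\<mu> + y) \<partial>lborel)"
    by (intro integral_gaussian_measure \<Psi>) measurable
  also have "\<dots> = (\<integral>y. gaussian_density \<Phi> y * f (\<mu> + y) \<partial>lborel)"
    using gaussian_integral_congruence[OF T \<Phi>, of "\<lambda>y. f (\<mu> + y)"] by (simp add: T\<Phi> fT)
  also have "\<dots> = (\<integral>y. f y \<partial>gaussian_measure \<mu> \<Phi>)"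
    by (rule integral_gaussian_measure[OF _ \<Phi>, symmetric]) simp
  finally show ?thesis ..
qed

section \<open>Uniform convergence over a bounded covariance model\<close>

lemma proj_matrix_orthogonal_comp:
  fixes L :: "(real^'n) set"
  assumes L: "subspace L"
  defines "P \<equiv> proj_matrix (L\<^sup>\<bottom>)"
  shows "transpose P = P" "P ** P = P" "P *v z = 0 \<longleftrightarrow> z \<in> L" "P *v z = z \<longleftrightarrow> z \<in> L\<^sup>\<bottom>"
proof -
  have K: "subspace (L\<^sup>\<bottom>)"
    by (rule subspace_orthogonal_comp)
  have P: "P *v x = orth_proj (L\<^sup>\<bottom>) x" for x
    unfolding P_def by (rule proj_matrix_mult[OF K])
  have in_K: "P *v x \<in> L\<^sup>\<bottom>" and res: "x - P *v x \<in> L" for x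
    using orth_proj[OF K, of x] unfolding P orthogonal_comp_self[OF L] by auto
  have orth: "(x - P *v x) \<bullet> (P *v y) = 0" for x y
    using in_K[of y] res[of x] by (auto simp: orthogonal_comp_def orthogonal_def inner_commute)
  show fix_iff: "P *v z = z \<longleftrightarrow> z \<in> L\<^sup>\<bottom>" for z
    using in_K[of z] orth_proj_eqI[OF K, of z z] subspace_0[OF subspace_orthogonal_comp]
    by (auto simp: P)
  show "P *v z = 0 \<longleftrightarrow> z \<in> L"
    using res[of z] orth_proj_eqI[OF K subspace_0[OF K], of z]
    by (auto simp: P orthogonal_comp_self[OF L])
  show "P ** P = P"
    using in_K fix_iff by (simp add: matrix_eq matrix_vector_mul_assoc[symmetric])
  have "x \<bullet> (P *v y) = (P *v x) \<bullet> y" for x y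
  proof -
    have "x \<bullet> (P *v y) = (P *v x) \<bullet> (P *v y)" "y \<bullet> (P *v x) = (P *v y) \<bullet> (P *v x)"
      using orth[of x y] orth[of y x] by (simp_all add: inner_diff_left)
    then show ?thesis
      by (metis inner_commute)
  qed
  then have "x \<bullet> (transpose P *v y) = x \<bullet> (P *v y)" for x y
    using inner_transpose_matrix[of x "transpose P" y] by (simp add: transpose_transpose del: transpose_matrix_vector)
  then show "transpose P = P"
    by (metis matrix_eq vector_eq_ldot)
qed

text \<open>The heart of the proof: although \<open>C\<close> need not be closed and its limit points may be singular, the
  expectations along any sequence in \<open>C\<close> accumulate at those of a nondegenerate Gaussian measure. Take a
  convergent subsequence with limit \<open>A\<close>. A nonsingular \<open>A\<close> is positive definite and serves itself. For
  singular \<open>A\<close> with column space \<open>L\<close>, the functions are invariant under scaling and under translation by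
  \<open>L\<close>, so the covariances may be divided by \<open>s\<close> and then replaced by their compressions to \<open>L\<^sup>\<bottom>\<close> plus
  the projection onto \<open>L\<close>; these converge to a positive definite matrix. One subsequence and one limit
  work for all functions at once.\<close>

lemma gaussian_expectation_subsequence:
  fixes C :: "(real^'n^'n) set" and F :: "(real^'n \<Rightarrow> real) set" and S :: "nat \<Rightarrow> real^'n^'n"
  assumes C: "\<And>A. A \<in> C \<Longrightarrow> pos_def_matrix A" "bounded C"
    and sing: "\<And>S A. (\<And>m. S m \<in> C) \<Longrightarrow> S \<longlonglongrightarrow> A \<Longrightarrow> det A = 0 \<Longrightarrow>
           \<exists>(m :: nat \<Rightarrow> nat) (s :: nat \<Rightarrow> real) D.
             strict_mono m \<and> (\<forall>i. s (m i) > 0) \<and>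
             (\<lambda>i. (1 / s (m i)) *\<^sub>R
                (proj_matrix ((column_space A)\<^sup>\<bottom>) ** S (m i) ** proj_matrix ((column_space A)\<^sup>\<bottom>)))
               \<longlonglongrightarrow> D \<and>
             inj_on (\<lambda>x. D *v x) ((column_space A)\<^sup>\<bottom>)"
    and \<mu>: "\<mu> \<in> M"
    and F_meas: "\<And>f. f \<in> F \<Longrightarrow> f \<in> borel_measurable borel"
    and F_01: "\<And>f y. f \<in> F \<Longrightarrow> 0 \<le> f y \<and> f y \<le> 1"
    and F_inv: "\<And>f. f \<in> F \<Longrightarrow> almost_invariant (invariance_group M) f"
    and F_shift: "\<And>f x z. f \<in> F \<Longrightarrow> z \<in> concentration_set C \<Longrightarrow> f (x + z) = f x"
    and S: "\<And>m. S m \<in> C"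
  shows "\<exists>m \<Psi>. strict_mono m \<and> pos_def_matrix \<Psi> \<and>
    (\<forall>f\<in>F. (\<lambda>i. \<integral>y. f y \<partial>gaussian_measure \<mu> (S (m i))) \<longlonglongrightarrow> (\<integral>y. f y \<partial>gaussian_measure \<mu> \<Psi>))"
proof -
  obtain A m\<^sub>1 where m\<^sub>1: "strict_mono m\<^sub>1" "(S \<circ> m\<^sub>1) \<longlonglongrightarrow> A"
    using bounded_imp_convergent_subsequence[OF bounded_subset[OF C(2)], of S] S by blast
  show ?thesis
  proof (cases "det A = 0")
    case False
    have pd: "pos_def_matrix ((S \<circ> m\<^sub>1) i)" for i
      using S C by simp
    have A: "pos_def_matrix A"
      by (rule pos_def_limit_nonsingular[OF m\<^sub>1(2) pd False])
    show ?thesis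
      using m\<^sub>1(1) A gaussian_expectation_tendsto[OF pd m\<^sub>1(2) A F_meas] F_01
      by (intro exI[of _ m\<^sub>1] exI[of _ A]) auto
  next
    case True
    define L where "L = column_space A"
    define P where "P = proj_matrix (L\<^sup>\<bottom>)"
    have L: "subspace L"
      by (simp add: L_def column_space_def)
    note P = proj_matrix_orthogonal_comp[OF L, folded P_def]
    obtain m\<^sub>2 s D where m\<^sub>2: "strict_mono m\<^sub>2" "\<And>i. s (m\<^sub>2 i) > 0"
      "(\<lambda>i. (1 / s (m\<^sub>2 i)) *\<^sub>R (P ** (S \<circ> m\<^sub>1) (m\<^sub>2 i) ** P)) \<longlonglongrightarrow> D"
      "inj_on (\<lambda>x. D *v x) (L\<^sup>\<bottom>)"
      using sing[of "S \<circ> m\<^sub>1" A] S m\<^sub>1(2) True unfolding P_def L_def by auto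
    \<comment> \<open>rescaled so that the part orthogonal to \<open>L\<close> neither vanishes nor explodes\<close>
    define B where "B i = (1 / s (m\<^sub>2 i)) *\<^sub>R S (m\<^sub>1 (m\<^sub>2 i))" for i
    have pd: "pos_def_matrix (S i)" for i
      using S C by simp
    have B: "pos_def_matrix (B i)" for i
      using pd[of "m\<^sub>1 (m\<^sub>2 i)"] m\<^sub>2(2)[of i]
      by (auto simp: B_def pos_def_matrix_def transpose_scalar scaleR_matrix_vector_assoc[symmetric])
    have "P ** B i ** P = (1 / s (m\<^sub>2 i)) *\<^sub>R (P ** (S \<circ> m\<^sub>1) (m\<^sub>2 i) ** P)" for i
      by (simp add: B_def matrix_scalar_ac scalar_matrix_assoc)
    then have lim: "(\<lambda>i. P ** B i ** P) \<longlonglongrightarrow> D"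
      using m\<^sub>2(3) by simp
    have \<Psi>: "pos_def_matrix (D + (mat 1 - P))"
      using m\<^sub>2(4) by (intro pos_def_limit_compression[OF B lim P(1,2)]) (simp add: P(4))
    have "(\<lambda>i. \<integral>y. f y \<partial>gaussian_measure \<mu> (S (m\<^sub>1 (m\<^sub>2 i))))
        \<longlonglongrightarrow> (\<integral>y. f y \<partial>gaussian_measure \<mu> (D + (mat 1 - P)))" if f: "f \<in> F" for f
    proof -
      have shift: "f (x + z) = f x" if "P *v z = 0" for x z
      proof (rule F_shift[OF f])
        have "\<exists>S'. (\<forall>i. S' i \<in> C) \<and> S' \<longlonglongrightarrow> A"
          using m\<^sub>1(2) S by (intro exI[of _ "S \<circ> m\<^sub>1"]) simp
        moreover have "z \<in> column_space A"
          using that P(3) by (simp add: L_def)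
        ultimately show "z \<in> concentration_set C"
          unfolding concentration_set_def using True by blast
      qed
      have "(\<integral>y. f y \<partial>gaussian_measure \<mu> (S (m\<^sub>1 (m\<^sub>2 i))))
          = (\<integral>y. f y \<partial>gaussian_measure \<mu> (P ** B i ** P + (mat 1 - P)))" for i
      proof -
        have "(\<integral>y. f y \<partial>gaussian_measure \<mu> (S (m\<^sub>1 (m\<^sub>2 i)))) = (\<integral>y. f y \<partial>gaussian_measure \<mu> (B i))"
          unfolding B_def using m\<^sub>2(2)
          by (intro gaussian_integral_invariance_group[OF F_inv[OF f] \<mu> \<mu> _ pd F_meas[OF f], symmetric]) simp
        also have "\<dots> = (\<integral>y. f y \<partial>gaussian_measure \<mu> (P ** B i ** P + (mat 1 - P)))"
          by (rule gaussian_integral_compression[OF B P(1,2) F_meas[OF f] shift])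
        finally show ?thesis .
      qed
      moreover have "(\<lambda>i. \<integral>y. f y \<partial>gaussian_measure \<mu> (P ** B i ** P + (mat 1 - P)))
          \<longlonglongrightarrow> (\<integral>y. f y \<partial>gaussian_measure \<mu> (D + (mat 1 - P)))"
        using F_01[OF f]
        by (intro gaussian_expectation_tendsto pos_def_compression B P \<Psi> F_meas f tendsto_add lim tendsto_const) auto
      ultimately show ?thesis
        by simp
    qed
    then show ?thesis
      using strict_mono_o[OF m\<^sub>1(1) m\<^sub>2(1)] \<Psi>
      by (intro exI[of _ "m\<^sub>1 \<circ> m\<^sub>2"] exI[of _ "D + (mat 1 - P)"]) (auto simp: o_def)
  qed
qed

theorem theorem5p12:
  fixes X :: "real^'k^'n"
    and R :: "real^'k^'q"
    and r :: "real^'q"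
    and C :: "(real^'n^'n) set"
    and \<phi> :: "nat \<Rightarrow> real^'n \<Rightarrow> real"
  assumes "CARD('k) < CARD('n)"
    and "rank X = CARD('k)"
    and "rank R = CARD('q)"
    and "covariance_model C"
    and "\<And>j. j \<ge> 1 \<Longrightarrow> \<phi> j \<in> borel_measurable borel"
    and "\<And>j y. j \<ge> 1 \<Longrightarrow> 0 \<le> \<phi> j y \<and> \<phi> j y \<le> 1"
    and "\<And>j. j \<ge> 1 \<Longrightarrow> almost_invariant (invariance_group (null_hypothesis X R r)) (\<phi> j)"
    and "\<And>j. j \<ge> 1 \<Longrightarrow> \<not> (AE y in lborel. \<phi> j y = 1)"
    and "\<And>j. j \<ge> 1 \<Longrightarrow> \<not> (AE y in lborel. \<phi> j y = 0)"
    and "\<And>j x z. j \<ge> 1 \<Longrightarrow> z \<in> concentration_set C \<Longrightarrow> \<phi> j (x + z) = \<phi> j x"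
    and "bounded C"
    and "\<And>S A. (\<And>m. S m \<in> C) \<Longrightarrow> S \<longlonglongrightarrow> A \<Longrightarrow> det A = 0 \<Longrightarrow>
           \<exists>(m :: nat \<Rightarrow> nat) (s :: nat \<Rightarrow> real) D.
             strict_mono m \<and> (\<forall>i. s (m i) > 0) \<and>
             (\<lambda>i. (1 / s (m i)) *\<^sub>R
                (proj_matrix ((column_space A)\<^sup>\<bottom>) ** S (m i) ** proj_matrix ((column_space A)\<^sup>\<bottom>)))
               \<longlonglongrightarrow> D \<and>
             inj_on (\<lambda>x. D *v x) ((column_space A)\<^sup>\<bottom>)"
    and "\<exists>\<mu>\<in>null_hypothesis X R r. \<forall>\<Phi>. pos_def_matrix \<Phi> \<longrightarrow>
           (\<forall>j\<ge>1. (\<integral>y. \<phi> (Suc j) y \<partial>gaussian_measure \<mu> \<Phi>) \<le> (\<integral>y. \<phi> j y \<partial>gaussian_measure \<mu> \<Phi>)) \<and>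
           (\<lambda>j. \<integral>y. \<phi> j y \<partial>gaussian_measure \<mu> \<Phi>) \<longlonglongrightarrow> 0"
  shows "\<forall>\<delta>::real. 0 < \<delta> \<and> \<delta> < 1 \<longrightarrow>
           (\<exists>j\<^sub>0\<ge>1.
              (SUP \<mu>\<in>null_hypothesis X R r. SUP v\<in>{0<..}. SUP A\<in>C.
                 ereal (\<integral>y. \<phi> j\<^sub>0 y \<partial>gaussian_measure \<mu> (v *\<^sub>R A))) \<le> ereal \<delta>)"
proof (intro allI impI, elim conjE)
  fix \<delta> :: real
  assume \<delta>: "0 < \<delta>" "\<delta> < 1"
  let ?M = "null_hypothesis X R r"
  obtain \<mu>\<^sub>0 where \<mu>\<^sub>0: "\<mu>\<^sub>0 \<in> ?M" and dec: "\<And>\<Phi>. pos_def_matrix \<Phi> \<Longrightarrow>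
           (\<forall>j\<ge>1. (\<integral>y. \<phi> (Suc j) y \<partial>gaussian_measure \<mu>\<^sub>0 \<Phi>) \<le> (\<integral>y. \<phi> j y \<partial>gaussian_measure \<mu>\<^sub>0 \<Phi>)) \<and>
           (\<lambda>j. \<integral>y. \<phi> j y \<partial>gaussian_measure \<mu>\<^sub>0 \<Phi>) \<longlonglongrightarrow> 0"
    using assms(13) by blast
  define E where "E j \<Phi> = (\<integral>y. \<phi> j y \<partial>gaussian_measure \<mu>\<^sub>0 \<Phi>)" for j \<Phi>
  have C: "pos_def_matrix A" if "A \<in> C" for A
    using assms(4) that by (simp add: covariance_model_def)
  have E_inv: "(\<integral>y. \<phi> j y \<partial>gaussian_measure \<mu> (v *\<^sub>R A)) = E j A"
    if "j \<ge> 1" "\<mu> \<in> ?M" "v > 0" "A \<in> C" for j \<mu> v A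
    unfolding E_def
    by (rule gaussian_integral_invariance_group[OF assms(7)[OF that(1)] that(2) \<mu>\<^sub>0 that(3) C[OF that(4)]
          assms(5)[OF that(1)]])
  have E_mono: "E i \<Phi> \<le> E j \<Phi>" if "pos_def_matrix \<Phi>" "1 \<le> j" "j \<le> i" for i j \<Phi>
    using that(3)
  proof (induction i rule: dec_induct)
    case (step i)
    then show ?case
      using dec[OF that(1)] that(2) unfolding E_def by (meson le_trans order_trans)
  qed simp
  \<comment> \<open>uniformity over \<open>C\<close>, by a Dini type argument: by monotonicity in \<open>j\<close>, violations along a
    sequence in \<open>C\<close> pass to the limit for every fixed \<open>j\<close>\<close>
  have "\<exists>j\<ge>1. \<forall>A\<in>C. E j A \<le> \<delta>"
  proof (rule ccontr)
    assume "\<not> (\<exists>j\<ge>1. \<forall>A\<in>C. E j A \<le> \<delta>)"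
    \<comment> \<open>\<open>Suc\<close> because the tests are indexed from \<open>1\<close>\<close>
    then have "\<exists>A. A \<in> C \<and> \<delta> < E (Suc m) A" for m
      by (metis not_le le_add1 plus_1_eq_Suc)
    then obtain S where S: "\<And>m. S m \<in> C" "\<And>m. \<delta> < E (Suc m) (S m)"
      by metis
    obtain m \<Psi> where m: "strict_mono m" and \<Psi>: "pos_def_matrix \<Psi>" and
      lim: "\<And>f. f \<in> \<phi> ` {1..} \<Longrightarrow>
        (\<lambda>i. \<integral>y. f y \<partial>gaussian_measure \<mu>\<^sub>0 (S (m i))) \<longlonglongrightarrow> (\<integral>y. f y \<partial>gaussian_measure \<mu>\<^sub>0 \<Psi>)"
    proof -
      have "\<exists>m \<Psi>. strict_mono m \<and> pos_def_matrix \<Psi> \<and> (\<forall>f\<in>\<phi> ` {1..}.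
        (\<lambda>i. \<integral>y. f y \<partial>gaussian_measure \<mu>\<^sub>0 (S (m i))) \<longlonglongrightarrow> (\<integral>y. f y \<partial>gaussian_measure \<mu>\<^sub>0 \<Psi>))"
      proof (rule gaussian_expectation_subsequence[where C = C and M = ?M])
        show "f (x + z) = f x" if "f \<in> \<phi> ` {1..}" "z \<in> concentration_set C" for f x z
          using that assms(10) by auto
        show "0 \<le> f y \<and> f y \<le> 1" if "f \<in> \<phi> ` {1..}" for f y
          using that assms(6) by auto
        show "f \<in> borel_measurable borel" "almost_invariant (invariance_group ?M) f"
          if "f \<in> \<phi> ` {1..}" for f
          using that assms(5,7) by auto
      qed (fact C assms(11,12) \<mu>\<^sub>0 S(1))+
      then show thesis
        using that by blast
    qed
    have "\<delta> \<le> E j \<Psi>" if "j \<ge> 1" for j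
    proof (rule tendsto_lowerbound)
      show "(\<lambda>i. E j (S (m i))) \<longlonglongrightarrow> E j \<Psi>"
        using lim that by (simp add: E_def)
      show "\<forall>\<^sub>F i in sequentially. \<delta> \<le> E j (S (m i))"
      proof (rule eventually_sequentiallyI)
        fix i assume "j \<le> i"
        then have "j \<le> Suc (m i)"
          using seq_suble[OF m, of i] by linarith
        then show "\<delta> \<le> E j (S (m i))"
          using S(2)[of "m i"] E_mono[OF C[OF S(1)] that] by (meson less_imp_le order_trans)
      qed
    qed simp
    then have "\<delta> \<le> 0"
      using dec[OF \<Psi>] unfolding E_def
      by (intro LIMSEQ_le_const[of "\<lambda>j. \<integral>y. \<phi> j y \<partial>gaussian_measure \<mu>\<^sub>0 \<Psi>"]) auto
    with \<delta> show False
      by simp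
  qed
  then obtain j where j: "j \<ge> 1" "\<And>A. A \<in> C \<Longrightarrow> E j A \<le> \<delta>"
    by blast
  show "\<exists>j\<^sub>0\<ge>1. (SUP \<mu>\<in>?M. SUP v\<in>{0<..}. SUP A\<in>C.
      ereal (\<integral>y. \<phi> j\<^sub>0 y \<partial>gaussian_measure \<mu> (v *\<^sub>R A))) \<le> ereal \<delta>"
    using j by (intro exI[of _ j] conjI SUP_least) (auto simp: E_inv)
qed

end
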